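(* For all integers $r\geq 1$ and $k\geq 2$, $$\mathrm{ex}(n,C_{2k}[r])=O\left(n^{2-\frac{1}{r}+\frac{1}{k+r-1}}(\log n)^{\frac{4k}{r(k+r-1)}}\right).$$
   Context: For a graph $F$, the $r$-blowup $F[r]$ is obtained by replacing each vertex of $F$ by an independent set of size $r$ and each edge of $F$ by a complete bipartite graph $K_{r,r}$. $\mathrm{ex}(n,H)$ is the maximum number of edges in an $n$-vertex graph with no subgraph isomorphic to $H$. Logarithms are base $2$. *)

theory Defs
  imports Complex_Main "HOL-Library.Landau_Symbols"
begin

definition is_graph :: "'a set \<Rightarrow> 'a set set \<Rightarrow> bool" where
  "is_graph V E \<longleftrightarrow> (\<forall>e\<in>E. e \<subseteq> V \<and> card e = 2)"

definition contains_copy :: "'a set \<Rightarrow> 'a set set \<Rightarrow> 'b set \<Rightarrow> 'b set set \<Rightarrow> bool" where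
  "contains_copy VG EG VH EH \<longleftrightarrow>
     (\<exists>f. inj_on f VH \<and> f ` VH \<subseteq> VG \<and> (\<forall>e\<in>EH. f ` e \<in> EG))"

definition ex_num :: "nat \<Rightarrow> 'b set \<Rightarrow> 'b set set \<Rightarrow> nat" where
  "ex_num n VH EH = Max {card E | E. is_graph {0..<n} E \<and> \<not> contains_copy {0..<n} E VH EH}"

definition cycle_V :: "nat \<Rightarrow> nat set" where
  "cycle_V m = {0..<m}"
definition cycle_E :: "nat \<Rightarrow> nat set set" where
  "cycle_E m = {{i, (i + 1) mod m} | i. i < m}"

definition blowup_V :: "'a set \<Rightarrow> nat \<Rightarrow> ('a \<times> nat) set" where
  "blowup_V V r = V \<times> {0..<r}"
definition blowup_E :: "'a set set \<Rightarrow> nat \<Rightarrow> ('a \<times> nat) set set" where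
  "blowup_E E r = {{(u, i), (v, j)} | u v i j. {u, v} \<in> E \<and> u \<noteq> v \<and> i < r \<and> j < r}"

end

theory Submission
  imports Defs "HOL-Analysis.Convex"
begin

text \<open>
  Let \<open>\<G>\<close> be the auxiliary graph whose vertices are the \<open>r\<close>-subsets of \<open>V\<close>, two of them being
  adjacent if they are completely joined in \<open>G\<close>. A copy of \<open>C\<^sub>2\<^sub>k[r]\<close> is a closed walk of length
  \<open>2k\<close> in \<open>\<G>\<close> whose vertices are pairwise disjoint. Writing \<open>d z\<close> for the number of common
  neighbours of \<open>z\<close>, first delete vertices of \<open>\<G>\<close> until every surviving \<open>z\<close> has degree
  \<open>h z \<ge> \<delta> (d z)\<^bsup>r-1\<^esup> + \<delta>\<^sup>r\<close>. Weight the closed walks by the normalised adjacency matrix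
  \<open>W x y = [x \<sim> y] / sqrt (h x h y)\<close>, which fixes the vector \<open>sqrt h\<close>. Only minimum degrees
  matter for \<open>W\<close>, so that no regularisation of \<open>\<G>\<close>, and hence no logarithm, is needed.

  With \<open>P\<^sub>v\<close> the projection to the sets containing \<open>v\<close>, the walks in which two vertices at
  distance \<open>l\<close> intersect have weight at most \<open>\<Sum>\<^sub>v tr (P\<^sub>v W\<^sup>l P\<^sub>v W\<^bsup>2k-l\<^esup>)\<close>. This is zero for \<open>l = 1\<close>,
  and for \<open>2 \<le> l \<le> 2k-2\<close> it is, by convexity in \<open>l\<close>, largest at \<open>l = 2\<close>, where diagonal
  dominance bounds it by \<open>(r/\<delta>) tr W\<^bsup>2k-2\<^esup>\<close>. If all closed walks were of this kind, then
  \<open>tr W\<^bsup>2k\<^esup> \<le> c tr W\<^bsup>2k-2\<^esup>\<close> with \<open>c = O(1/\<delta>)\<close>, and log-convexity of \<open>j \<mapsto> tr W\<^bsup>2j\<^esup>\<close> would give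
  \<open>1 \<le> tr W\<^bsup>2k\<^esup> \<le> c\<^bsup>k-1\<^esup> tr W\<^sup>2 \<le> c\<^bsup>k-1\<^esup> n\<^sup>r / \<delta>\<^sup>r\<close>, which fails once \<open>\<delta>\<^bsup>k+r-1\<^esup>\<close> is a large
  multiple of \<open>n\<^sup>r\<close>. Counting shows that \<open>\<delta>\<close> may be taken of order \<open>n (e/n\<^sup>2)\<^sup>r\<close>.
\<close>

subsection \<open>Powers of symmetric kernels\<close>

primrec kpow :: "'b set \<Rightarrow> ('b \<Rightarrow> 'b \<Rightarrow> real) \<Rightarrow> nat \<Rightarrow> 'b \<Rightarrow> 'b \<Rightarrow> real" where
  "kpow U W 0 = (\<lambda>x y. of_bool (x = y))"
| "kpow U W (Suc n) = (\<lambda>x y. \<Sum>z\<in>U. kpow U W n x z * W z y)"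

text \<open>This is \<open>tr (P W\<^sup>p P W\<^sup>q)\<close> with \<open>P\<close> the projection to \<open>S\<close>; symmetry of \<open>W\<close> turns it into a
  Frobenius inner product, see \<open>pair_sum_eq_inner\<close>.\<close>

definition pair_sum :: "'b set \<Rightarrow> ('b \<Rightarrow> 'b \<Rightarrow> real) \<Rightarrow> 'b set \<Rightarrow> nat \<Rightarrow> nat \<Rightarrow> real" where
  "pair_sum U W S p q = (\<Sum>s\<in>S. \<Sum>t\<in>S. kpow U W p s t * kpow U W q s t)"

text \<open>Only even powers are traced: for symmetric \<open>W\<close> this is the squared
  Frobenius norm of \<open>W^n\<close>, which opens the way to Cauchy-Schwarz.\<close>

definition even_trace :: "'b set \<Rightarrow> ('b \<Rightarrow> 'b \<Rightarrow> real) \<Rightarrow> nat \<Rightarrow> real" where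
  "even_trace U W n = (\<Sum>x\<in>U. kpow U W (2 * n) x x)"

locale sym_kernel =
  fixes U :: "'b set" and W :: "'b \<Rightarrow> 'b \<Rightarrow> real"
  assumes finU: "finite U"
    and W_sym: "W x y = W y x"
    and W_nonneg: "0 \<le> W x y"
begin

lemma kpow_nonneg: "0 \<le> kpow U W n x y"
  by (induction n arbitrary: y) (auto intro!: sum_nonneg simp: W_nonneg)

lemma kpow_Suc_0: "x \<in> U \<Longrightarrow> kpow U W (Suc 0) x y = W x y"
  using finU by (simp add: of_bool_def if_distrib if_distribR sum.delta' cong: if_cong)

lemma kpow_add:
  assumes "y \<in> U"
  shows "kpow U W (m + n) x y = (\<Sum>z\<in>U. kpow U W m x z * kpow U W n z y)"
  using assms
proof (induction n arbitrary: y)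
  case 0
  then show ?case using finU
    by (simp add: of_bool_def if_distrib if_distribR sum.delta cong: if_cong)
next
  case (Suc n)
  have "kpow U W (m + Suc n) x y = (\<Sum>w\<in>U. (\<Sum>z\<in>U. kpow U W m x z * kpow U W n z w) * W w y)"
    using Suc.IH by simp
  also have "\<dots> = (\<Sum>z\<in>U. \<Sum>w\<in>U. kpow U W m x z * kpow U W n z w * W w y)"
    by (subst sum.swap) (simp add: sum_distrib_right)
  finally show ?case
    by (simp add: sum_distrib_left mult.assoc)
qed

lemma kpow_sym:
  assumes "x \<in> U" "y \<in> U"
  shows "kpow U W n x y = kpow U W n y x"
  using assms
proof (induction n arbitrary: x y)
  case (Suc n)
  have "kpow U W (Suc n) x y = (\<Sum>z\<in>U. kpow U W (Suc 0) y z * kpow U W n z x)"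
    using Suc by (auto simp: kpow_Suc_0 W_sym[of y] mult.commute simp del: kpow.simps(2)
        intro!: sum.cong[OF refl] simp: kpow.simps(2)[of U W n])
  also have "\<dots> = kpow U W (Suc 0 + n) y x"
    using Suc.prems by (subst kpow_add) auto
  finally show ?case by simp
qed auto

lemma kpow_add':
  assumes "x \<in> U" "y \<in> U"
  shows "kpow U W (m + n) x y = (\<Sum>z\<in>U. kpow U W m z x * kpow U W n z y)"
  using assms by (subst kpow_add) (auto intro!: sum.cong simp: kpow_sym)

lemma trace_kpow_add:
  "(\<Sum>x\<in>U. kpow U W (m + n) x x) = (\<Sum>x\<in>U. \<Sum>y\<in>U. kpow U W m x y * kpow U W n x y)"
  by (intro sum.cong refl) (auto simp: kpow_add kpow_sym intro!: sum.cong)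

lemma even_trace_eq: "even_trace U W n = (\<Sum>x\<in>U. \<Sum>y\<in>U. (kpow U W n x y)\<^sup>2)"
  using trace_kpow_add[of n n] by (simp add: even_trace_def mult_2 power2_eq_square)

lemma even_trace_nonneg: "0 \<le> even_trace U W n"
  by (simp add: even_trace_eq sum_nonneg)

text \<open>\<open>tr W^(2n+2)\<close> is the Frobenius inner product of \<open>W^n\<close> and
  \<open>W^(n+2)\<close>, so this is Cauchy-Schwarz.\<close>

lemma even_trace_log_convex:
  "(even_trace U W (Suc n))\<^sup>2 \<le> even_trace U W n * even_trace U W (Suc (Suc n))"
proof -
  have eq: "even_trace U W (Suc n)
      = (\<Sum>p\<in>U\<times>U. kpow U W n (fst p) (snd p) * kpow U W (Suc (Suc n)) (fst p) (snd p))"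
    using trace_kpow_add[of n "Suc (Suc n)"]
    by (simp add: even_trace_def sum.cartesian_product mult_2 case_prod_unfold del: kpow.simps)
  show ?thesis
    using Cauchy_Schwarz_ineq_sum[of "\<lambda>p. kpow U W n (fst p) (snd p)"
        "\<lambda>p. kpow U W (Suc (Suc n)) (fst p) (snd p)" "U \<times> U"]
    unfolding eq unfolding even_trace_eq
    by (simp add: sum.cartesian_product case_prod_unfold del: kpow.simps)
qed

lemma pair_sum_nonneg: "0 \<le> pair_sum U W S p q"
  unfolding pair_sum_def by (intro sum_nonneg mult_nonneg_nonneg kpow_nonneg)

lemma pair_sum_commute: "pair_sum U W S p q = pair_sum U W S q p"
  by (simp add: pair_sum_def mult.commute)

text \<open>Expand the inner product of the matrices \<open>W^i P W^j\<close> and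
  \<open>W^i' P W^j'\<close>: summing over \<open>x\<close> joins the powers \<open>i\<close> and
  \<open>i'\<close> between \<open>s\<close> and \<open>t\<close>, and summing over \<open>y\<close>
  joins \<open>j\<close> and \<open>j'\<close>. Both exponents of a pair sum can thus be split
  freely.\<close>

lemma pair_sum_eq_inner:
  assumes "S \<subseteq> U"
  shows "pair_sum U W S (i + i') (j + j') = (\<Sum>x\<in>U. \<Sum>y\<in>U.
    (\<Sum>s\<in>S. kpow U W i x s * kpow U W j s y) * (\<Sum>t\<in>S. kpow U W i' x t * kpow U W j' t y))"
    (is "_ = (\<Sum>x\<in>U. \<Sum>y\<in>U. ?f x y)")
proof -
  have f: "?f x y = (\<Sum>s\<in>S. \<Sum>t\<in>S. (kpow U W i x s * kpow U W i' x t) * (kpow U W j s y * kpow U W j' t y))" for x y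
    by (simp add: sum_product mult_ac)
  have "(\<Sum>x\<in>U. \<Sum>y\<in>U. ?f x y) = (\<Sum>x\<in>U. \<Sum>s\<in>S. \<Sum>y\<in>U. \<Sum>t\<in>S. (kpow U W i x s * kpow U W i' x t) * (kpow U W j s y * kpow U W j' t y))"
    unfolding f by (rule sum.cong[OF refl], rule sum.swap)
  also have "\<dots> = (\<Sum>s\<in>S. \<Sum>x\<in>U. \<Sum>t\<in>S. \<Sum>y\<in>U. (kpow U W i x s * kpow U W i' x t) * (kpow U W j s y * kpow U W j' t y))"
    by (subst sum.swap, rule sum.cong[OF refl], rule sum.cong[OF refl], rule sum.swap)
  also have "\<dots> = (\<Sum>s\<in>S. \<Sum>t\<in>S. \<Sum>x\<in>U. \<Sum>y\<in>U. (kpow U W i x s * kpow U W i' x t) * (kpow U W j s y * kpow U W j' t y))"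
    by (rule sum.cong[OF refl], rule sum.swap)
  also have "\<dots> = (\<Sum>s\<in>S. \<Sum>t\<in>S. kpow U W (i + i') s t * kpow U W (j + j') s t)"
  proof (intro sum.cong refl)
    fix s t assume "s \<in> S" "t \<in> S"
    then have st: "s \<in> U" "t \<in> U" using assms by auto
    have "kpow U W (j + j') s t = (\<Sum>y\<in>U. kpow U W j s y * kpow U W j' t y)"
      using st by (auto simp: kpow_add kpow_sym intro!: sum.cong)
    then show "(\<Sum>x\<in>U. \<Sum>y\<in>U. (kpow U W i x s * kpow U W i' x t) * (kpow U W j s y * kpow U W j' t y))
        = kpow U W (i + i') s t * kpow U W (j + j') s t"
      using st by (simp add: kpow_add'[of s t i i'] sum_product)
  qed
  finally show ?thesis by (simp add: pair_sum_def)
qed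

text \<open>The inequality \<open>2ab <= a^2 + b^2\<close> for the entries of
  \<open>W^i P W^j\<close> and \<open>W^i' P W^j'\<close>. When \<open>i + j = i' + j'\<close> it
  expresses convexity in the first exponent at fixed total length.\<close>

lemma pair_sum_midpoint:
  assumes "S \<subseteq> U"
  shows "2 * pair_sum U W S (i + i') (j + j')
    \<le> pair_sum U W S (2 * i) (2 * j) + pair_sum U W S (2 * i') (2 * j')"
proof -
  define a where "a i j x y = (\<Sum>s\<in>S. kpow U W i x s * kpow U W j s y)" for i j x y
  have inner: "pair_sum U W S (i + i') (j + j') = (\<Sum>x\<in>U. \<Sum>y\<in>U. a i j x y * a i' j' x y)" for i i' j j'
    unfolding a_def by (rule pair_sum_eq_inner[OF assms])
  have am: "2 * (b * c) \<le> b * b + c * c" for b c :: real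
    using sum_squares_bound[of b c] by (simp add: power2_eq_square)
  have "2 * pair_sum U W S (i + i') (j + j') = (\<Sum>x\<in>U. \<Sum>y\<in>U. 2 * (a i j x y * a i' j' x y))"
    unfolding inner by (simp only: sum_distrib_left)
  also have "\<dots> \<le> (\<Sum>x\<in>U. \<Sum>y\<in>U. a i j x y * a i j x y + a i' j' x y * a i' j' x y)"
    by (intro sum_mono am)
  also have "\<dots> = pair_sum U W S (i + i) (j + j) + pair_sum U W S (i' + i') (j' + j')"
    unfolding inner by (simp only: sum.distrib)
  finally show ?thesis by (simp only: mult_2)
qed

end

section \<open>Bounds for pair sums and even traces\<close>

lemma convex_symmetric_seq_le:
  fixes f :: "nat \<Rightarrow> real"
  assumes conv: "\<And>i. 1 < i \<Longrightarrow> i < n \<Longrightarrow> 2 * f i \<le> f (i - 1) + f (i + 1)"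
    and ends: "f n = f 1" and i: "1 \<le> i" "i \<le> n"
  shows "f i \<le> f 1"
proof -
  define m where "m = Max (f ` {1..n})"
  have ub: "f j \<le> m" if "1 \<le> j" "j \<le> n" for j
    unfolding m_def using that by (intro Max_ge) auto
  have "m \<in> f ` {1..n}" unfolding m_def using i by (intro Max_in) auto
  then have ex: "\<exists>j. 1 \<le> j \<and> j \<le> n \<and> f j = m" by auto
  \<comment> \<open>The least maximiser cannot be interior, since convexity would make its
    predecessor a maximiser too.\<close>
  define j where "j = (LEAST j. 1 \<le> j \<and> j \<le> n \<and> f j = m)"
  have j: "1 \<le> j" "j \<le> n" "f j = m"
    using LeastI_ex[OF ex] unfolding j_def by auto
  have "j = 1 \<or> j = n"
  proof (rule ccontr)
    assume "\<not> ?thesis"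
    then have j': "1 < j" "j < n" using j by auto
    then have "f (j - 1) = m"
      using conv[OF j'] ub[of "j - 1"] ub[of "j + 1"] j j' by (simp, linarith)
    then have "1 \<le> j - 1 \<and> j - 1 \<le> n \<and> f (j - 1) = m"
      using j' by auto
    then have "j \<le> j - 1"
      unfolding j_def[symmetric] by (rule Least_le[where P = "\<lambda>j. 1 \<le> j \<and> j \<le> n \<and> f j = m", folded j_def])
    then show False using j' by simp
  qed
  then have "f 1 = m" using j ends by auto
  then show ?thesis using ub[OF i] by simp
qed

context sym_kernel
begin

text \<open>Along the even exponents \<open>2, 4, ..., 2k-2\<close> the pair sum is convex with
  equal ends, hence largest at 2. An odd exponent is the midpoint of its two even neighbours
  \<open>2 * i\<close> and \<open>2 * i'\<close>.\<close>

lemma pair_sum_le_end: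
  assumes S: "S \<subseteq> U" and k: "2 \<le> k" and l: "2 \<le> l" "l + 2 \<le> 2 * k"
  shows "pair_sum U W S l (2 * k - l) \<le> pair_sum U W S 2 (2 * k - 2)"
proof -
  define f where "f i = pair_sum U W S (2 * i) (2 * (k - i))" for i
  have f_le: "f i \<le> f 1" if "1 \<le> i" "i \<le> k - 1" for i
  proof (rule convex_symmetric_seq_le[where n = "k - 1"])
    fix i assume i: "1 < i" "i < k - 1"
    have "(i - 1) + (i + 1) = 2 * i" "(k - (i - 1)) + (k - (i + 1)) = 2 * (k - i)"
      using i by auto
    then show "2 * f i \<le> f (i - 1) + f (i + 1)"
      using pair_sum_midpoint[OF S, of "i - 1" "i + 1" "k - (i - 1)" "k - (i + 1)"]
      by (simp only: f_def)
  next
    show "f (k - 1) = f 1"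
      using k by (simp add: f_def pair_sum_commute)
  qed (use that in auto)
  define i where "i = l div 2"
  define i' where "i' = l - l div 2"
  have ii: "l = i + i'" "2 * k - l = (k - i) + (k - i')" "1 \<le> i" "1 \<le> i'" "i \<le> k - 1" "i' \<le> k - 1"
    using l unfolding i_def i'_def by auto
  have "2 * pair_sum U W S l (2 * k - l) \<le> f i + f i'"
    using pair_sum_midpoint[OF S, of i i' "k - i" "k - i'"] by (simp only: f_def ii(1)[symmetric] ii(2)[symmetric])
  also have "\<dots> \<le> 2 * f 1"
    using f_le[of i] f_le[of i'] ii by simp
  finally show ?thesis
    by (simp add: f_def right_diff_distrib')
qed

text \<open>\<open>W^(2n)\<close> is a Gram matrix, so its entries are dominated by diagonal ones,
  with weights taken from \<open>u\<close>. What remains are the \<open>u\<close>-weighted row sums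
  of \<open>W^2\<close> over \<open>S\<close>.\<close>

lemma pair_sum_two_le:
  assumes S: "S \<subseteq> U"
    and upos: "\<And>x. x \<in> U \<Longrightarrow> 0 < u x"
    and eig: "\<And>x. x \<in> U \<Longrightarrow> (\<Sum>y\<in>U. W x y * u y) = u x"
    and eps: "\<And>z. z \<in> U \<Longrightarrow> (\<Sum>y\<in>S. W z y * u y) \<le> \<epsilon> * u z"
  shows "pair_sum U W S 2 (2 * n) \<le> \<epsilon> * (\<Sum>x\<in>S. kpow U W (2 * n) x x)"
proof -
  let ?M = "kpow U W"
  have M2: "?M 2 x y = (\<Sum>z\<in>U. W x z * W z y)" if "x \<in> U" for x y
  proof -
    have "?M 2 x y = (\<Sum>z\<in>U. ?M (Suc 0) x z * W z y)"
      by (simp only: numeral_2_eq_2 kpow.simps)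
    then show ?thesis using that by (simp only: kpow_Suc_0)
  qed
  \<comment> \<open>Of the two steps from \<open>s\<close> to \<open>t\<close>, the last one, into
    \<open>S\<close>, gains \<epsilon> by \<open>eps\<close>; the first one costs nothing by the
    eigenvector equation.\<close>
  have row: "(\<Sum>t\<in>S. ?M 2 s t * u t) \<le> \<epsilon> * u s" if "s \<in> S" for s
  proof -
    have s: "s \<in> U" using that S by auto
    have "(\<Sum>t\<in>S. ?M 2 s t * u t) = (\<Sum>t\<in>S. \<Sum>z\<in>U. W s z * (W z t * u t))"
      using s by (simp add: M2 sum_distrib_right mult.assoc)
    also have "\<dots> = (\<Sum>z\<in>U. W s z * (\<Sum>t\<in>S. W z t * u t))"
      by (subst sum.swap) (simp add: sum_distrib_left)
    also have "\<dots> \<le> (\<Sum>z\<in>U. W s z * (\<epsilon> * u z))"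
      by (intro sum_mono mult_left_mono eps W_nonneg)
    also have "\<dots> = \<epsilon> * (\<Sum>z\<in>U. W s z * u z)"
      by (simp add: sum_distrib_left mult_ac)
    finally show ?thesis using eig[OF s] by simp
  qed
  \<comment> \<open>AM-GM for the Gram vectors of \<open>s\<close> and \<open>t\<close>. The weights
    have product 1 and are chosen so that summing over \<open>t\<close> produces exactly the row sum
    just bounded.\<close>
  have diag: "?M (2 * n) s t \<le> (?M (2 * n) s s * (u t / u s) + ?M (2 * n) t t * (u s / u t)) / 2"
    if "s \<in> U" "t \<in> U" for s t
  proof -
    have pos: "0 < u s" "0 < u t" using upos that by auto
    have am: "2 * (a * b) \<le> a * a * (u t / u s) + b * b * (u s / u t)" for a b :: real
    proof -
      have "0 \<le> (a * u t - b * u s)\<^sup>2 / (u s * u t)"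
        using pos by (intro divide_nonneg_pos) auto
      also have "\<dots> = a * a * (u t / u s) + b * b * (u s / u t) - 2 * (a * b)"
        using pos by (simp add: field_simps power2_eq_square)
      finally show ?thesis by simp
    qed
    have dd: "?M (2 * n) x y = (\<Sum>z\<in>U. ?M n z x * ?M n z y)" if "x \<in> U" "y \<in> U" for x y
      using kpow_add'[OF that, of n n] by (simp add: mult_2)
    have "2 * ?M (2 * n) s t = (\<Sum>z\<in>U. 2 * (?M n z s * ?M n z t))"
      using that by (simp add: dd sum_distrib_left)
    also have "\<dots> \<le> (\<Sum>z\<in>U. ?M n z s * ?M n z s * (u t / u s) + ?M n z t * ?M n z t * (u s / u t))"
      by (intro sum_mono am)
    also have "\<dots> = ?M (2 * n) s s * (u t / u s) + ?M (2 * n) t t * (u s / u t)"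
      using that by (simp only: dd sum.distrib sum_distrib_right)
    finally show ?thesis by simp
  qed
  have "pair_sum U W S 2 (2 * n) \<le> (\<Sum>s\<in>S. \<Sum>t\<in>S. ?M 2 s t *
      ((?M (2 * n) s s * (u t / u s) + ?M (2 * n) t t * (u s / u t)) / 2))"
    unfolding pair_sum_def using S by (intro sum_mono mult_left_mono diag kpow_nonneg) auto
  also have "\<dots> = ((\<Sum>s\<in>S. \<Sum>t\<in>S. ?M 2 s t * ?M (2 * n) s s * (u t / u s))
      + (\<Sum>s\<in>S. \<Sum>t\<in>S. ?M 2 s t * ?M (2 * n) t t * (u s / u t))) / 2"
    by (simp add: sum.distrib[symmetric] sum_divide_distrib algebra_simps add_divide_distrib)
  also have "(\<Sum>s\<in>S. \<Sum>t\<in>S. ?M 2 s t * ?M (2 * n) t t * (u s / u t))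
      = (\<Sum>s\<in>S. \<Sum>t\<in>S. ?M 2 s t * ?M (2 * n) s s * (u t / u s))"
    using S by (subst sum.swap) (auto intro!: sum.cong simp: kpow_sym subset_iff)
  also have "((\<Sum>s\<in>S. \<Sum>t\<in>S. ?M 2 s t * ?M (2 * n) s s * (u t / u s)) + \<dots>) / 2
      = (\<Sum>s\<in>S. ?M (2 * n) s s / u s * (\<Sum>t\<in>S. ?M 2 s t * u t))"
    by (simp add: sum_distrib_left mult_ac)
  also have "\<dots> \<le> (\<Sum>s\<in>S. ?M (2 * n) s s / u s * (\<epsilon> * u s))"
    using S upos by (intro sum_mono mult_left_mono row divide_nonneg_nonneg kpow_nonneg) (auto simp: subset_iff less_imp_le)
  also have "\<dots> = (\<Sum>s\<in>S. \<epsilon> * ?M (2 * n) s s)"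
  proof (intro sum.cong refl)
    fix s assume "s \<in> S"
    then have "0 < u s" using upos S by auto
    then show "?M (2 * n) s s / u s * (\<epsilon> * u s) = \<epsilon> * ?M (2 * n) s s" by simp
  qed
  finally show ?thesis by (simp add: sum_distrib_left)
qed

lemma kpow_eigen:
  assumes eig: "\<And>x. x \<in> U \<Longrightarrow> (\<Sum>y\<in>U. W x y * u y) = u x" and "x \<in> U"
  shows "(\<Sum>y\<in>U. kpow U W n x y * u y) = u x"
  using \<open>x \<in> U\<close>
proof (induction n)
  case 0
  then show ?case using finU
    by (simp add: of_bool_def if_distrib if_distribR sum.delta' cong: if_cong)
next
  case (Suc n)
  have "(\<Sum>y\<in>U. kpow U W (Suc n) x y * u y) = (\<Sum>z\<in>U. kpow U W n x z * (\<Sum>y\<in>U. W z y * u y))"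
    by (simp add: sum_distrib_right sum_distrib_left mult.assoc) (rule sum.swap)
  then show ?case using Suc eig by simp
qed

text \<open>As \<open>W^n\<close> fixes \<open>u\<close>, the squared norm \<open>N\<close> of
  \<open>u\<close> is the inner product of \<open>W^n\<close> with the rank-one matrix of entries
  \<open>u x * u y\<close>, whose Frobenius norm is \<open>N\<close>. Cauchy-Schwarz gives
  \<open>N^2 <= tr W^(2n) * N^2\<close>.\<close>

lemma even_trace_ge_1:
  assumes eig: "\<And>x. x \<in> U \<Longrightarrow> (\<Sum>y\<in>U. W x y * u y) = u x"
    and upos: "\<And>x. x \<in> U \<Longrightarrow> 0 < u x" and ne: "U \<noteq> {}"
  shows "1 \<le> even_trace U W n"
proof -
  define N where "N = (\<Sum>x\<in>U. (u x)\<^sup>2)"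
  have N: "0 < N" unfolding N_def using upos ne finU
    by (intro sum_pos) (auto simp: less_imp_neq[THEN not_sym])
  have "N = (\<Sum>x\<in>U. u x * (\<Sum>y\<in>U. kpow U W n x y * u y))"
    by (simp add: kpow_eigen[OF eig] N_def power2_eq_square)
  also have "\<dots> = (\<Sum>p\<in>U\<times>U. kpow U W n (fst p) (snd p) * (u (fst p) * u (snd p)))"
    by (simp add: sum.cartesian_product[symmetric] sum_distrib_left case_prod_unfold mult_ac
        sum.cartesian_product)
  finally have eq: "N = (\<Sum>p\<in>U\<times>U. kpow U W n (fst p) (snd p) * (u (fst p) * u (snd p)))" .
  have "N\<^sup>2 \<le> (\<Sum>p\<in>U\<times>U. (kpow U W n (fst p) (snd p))\<^sup>2) * (\<Sum>p\<in>U\<times>U. (u (fst p) * u (snd p))\<^sup>2)"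
    unfolding eq by (rule Cauchy_Schwarz_ineq_sum)
  also have "(\<Sum>p\<in>U\<times>U. (kpow U W n (fst p) (snd p))\<^sup>2) = even_trace U W n"
    by (simp add: even_trace_eq sum.cartesian_product case_prod_unfold)
  also have "(\<Sum>p\<in>U\<times>U. (u (fst p) * u (snd p))\<^sup>2) = N\<^sup>2"
    by (simp add: N_def power_mult_distrib power2_eq_square[of "sum _ _"] sum_product
        sum.cartesian_product case_prod_unfold)
  finally show ?thesis using N by simp
qed

end

subsection \<open>Closed walks\<close>

lemma sum_PiE_atMost_Suc:
  "(\<Sum>f\<in>PiE {..Suc m} (\<lambda>_. U). F f) = (\<Sum>f\<in>PiE {..m} (\<lambda>_. U). \<Sum>y\<in>U. F (f(Suc m := y)))"
proof -
  have "PiE {..Suc m} (\<lambda>_. U) = (\<lambda>(y, f). f(Suc m := y)) ` (U \<times> PiE {..m} (\<lambda>_. U))"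
    unfolding atMost_Suc by (rule PiE_insert_eq)
  moreover have "inj_on (\<lambda>(y, f). f(Suc m := y)) (U \<times> PiE {..m} (\<lambda>_. U))"
    by (rule inj_combinator) simp
  ultimately have "(\<Sum>f\<in>PiE {..Suc m} (\<lambda>_. U). F f)
      = (\<Sum>(y, f)\<in>U \<times> PiE {..m} (\<lambda>_. U). F (f(Suc m := y)))"
    by (simp add: sum.reindex case_prod_unfold)
  also have "\<dots> = (\<Sum>y\<in>U. \<Sum>f\<in>PiE {..m} (\<lambda>_. U). F (f(Suc m := y)))"
    by (simp add: sum.cartesian_product)
  finally show ?thesis by (simp add: sum.swap[of _ U])
qed

lemma sum_PiE_atMost_0:
  "(\<Sum>f\<in>PiE {..0::nat} (\<lambda>_. U). F (f 0)) = (\<Sum>y\<in>U. F y)"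
proof (rule sum.reindex_bij_betw)
  show "bij_betw (\<lambda>f. f 0) (PiE {..0::nat} (\<lambda>_. U)) U"
  proof (rule bij_betw_byWitness[where f' = "\<lambda>y. (\<lambda>_. undefined)(0 := y)"])
    show "\<forall>f\<in>PiE {..0::nat} (\<lambda>_. U). (\<lambda>_. undefined)(0 := f 0) = f"
      by (auto simp: PiE_def extensional_def fun_eq_iff)
  qed (auto simp: PiE_def extensional_def)
qed

text \<open>The walk is open, with \<open>m\<close> edges. A closed walk of length
  \<open>m + 1\<close> carries the additional factor \<open>W (f m) (f 0)\<close>.\<close>

definition walk_weight :: "('b \<Rightarrow> 'b \<Rightarrow> real) \<Rightarrow> nat \<Rightarrow> (nat \<Rightarrow> 'b) \<Rightarrow> real" where
  "walk_weight W m f = (\<Prod>l<m. W (f l) (f (Suc l)))"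

lemma walk_weight_upd: "walk_weight W (Suc m) (f(Suc m := y)) = walk_weight W m f * W (f m) y"
proof -
  have "(\<Prod>l<m. W ((f(Suc m := y)) l) ((f(Suc m := y)) (Suc l))) = (\<Prod>l<m. W (f l) (f (Suc l)))"
    by (rule prod.cong) auto
  then show ?thesis by (simp add: walk_weight_def)
qed

context sym_kernel
begin

text \<open>Summing out the last \<open>d\<close> vertices turns their edges into a power of
  \<open>W\<close>, because the factor \<open>g\<close> sees only the first part of the walk and its
  last vertex. The induction absorbs one final edge at a time into \<open>g\<close>.\<close>

lemma sum_walks_cut:
  assumes dep: "\<And>f f' b. (\<And>l. l \<le> i \<Longrightarrow> f l = f' l) \<Longrightarrow> g f b = g f' b"
  shows "(\<Sum>f\<in>PiE {..i + d} (\<lambda>_. U). walk_weight W (i + d) f * g f (f (i + d)))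
       = (\<Sum>f\<in>PiE {..i} (\<lambda>_. U). walk_weight W i f * (\<Sum>b\<in>U. kpow U W d (f i) b * g f b))"
  using dep
proof (induction d arbitrary: g)
  case 0
  have "(\<Sum>b\<in>U. of_bool (f i = b) * g f b) = g f (f i)" if "f \<in> PiE {..i} (\<lambda>_. U)" for f
  proof -
    have "f i \<in> U" using that by auto
    then show ?thesis using finU
      by (simp add: of_bool_def if_distrib if_distribR cong: if_cong)
  qed
  then show ?case by simp
next
  case (Suc d)
  define g' where "g' f b = (\<Sum>y\<in>U. W b y * g f y)" for f b
  have g_upd: "g (f(Suc (i + d) := y)) b = g f b" for f y b
    by (rule Suc.prems) auto
  have dep': "g' f b = g' f' b" if "\<And>l. l \<le> i \<Longrightarrow> f l = f' l" for f f' b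
    unfolding g'_def by (intro sum.cong refl arg_cong2[where f = "(*)"] Suc.prems that)
  have "(\<Sum>f\<in>PiE {..i + Suc d} (\<lambda>_. U). walk_weight W (i + Suc d) f * g f (f (i + Suc d)))
      = (\<Sum>f\<in>PiE {..i + d} (\<lambda>_. U). walk_weight W (i + d) f * g' f (f (i + d)))"
    by (simp add: sum_PiE_atMost_Suc walk_weight_upd g_upd g'_def sum_distrib_left mult.assoc)
  also have "\<dots> = (\<Sum>f\<in>PiE {..i} (\<lambda>_. U). walk_weight W i f * (\<Sum>b\<in>U. kpow U W d (f i) b * g' f b))"
    by (rule Suc.IH) (rule dep')
  also have "\<dots> = (\<Sum>f\<in>PiE {..i} (\<lambda>_. U). walk_weight W i f * (\<Sum>b\<in>U. kpow U W (Suc d) (f i) b * g f b))"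
  proof (rule sum.cong[OF refl], rule arg_cong[where f = "\<lambda>c. _ * c"])
    fix f
    have "(\<Sum>b\<in>U. kpow U W d (f i) b * g' f b) = (\<Sum>b\<in>U. \<Sum>y\<in>U. kpow U W d (f i) b * W b y * g f y)"
      by (simp add: g'_def sum_distrib_left mult.assoc)
    also have "\<dots> = (\<Sum>b\<in>U. kpow U W (Suc d) (f i) b * g f b)"
      by (subst sum.swap) (simp add: sum_distrib_right)
    finally show "(\<Sum>b\<in>U. kpow U W d (f i) b * g' f b) = (\<Sum>b\<in>U. kpow U W (Suc d) (f i) b * g f b)" .
  qed
  finally show ?case .
qed

lemma sum_closed_walks:
  "(\<Sum>f\<in>PiE {..m} (\<lambda>_. U). walk_weight W m f * W (f m) (f 0)) = (\<Sum>x\<in>U. kpow U W (Suc m) x x)"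
proof -
  have "(\<Sum>f\<in>PiE {..0 + m} (\<lambda>_. U). walk_weight W (0 + m) f * W (f (0 + m)) (f 0))
      = (\<Sum>f\<in>PiE {..0} (\<lambda>_. U). walk_weight W 0 f * (\<Sum>b\<in>U. kpow U W m (f 0) b * W b (f 0)))"
    by (rule sum_walks_cut) auto
  then show ?thesis
    by (simp add: walk_weight_def sum_PiE_atMost_0[where F = "\<lambda>x. \<Sum>b\<in>U. kpow U W m x b * W b x"] del: atMost_0)
qed

text \<open>The marks split the closed walk into arcs of lengths \<open>l\<close> and
  \<open>d + 1 + i\<close>, the second one through the closing edge. The walk is cut at position
  \<open>i + l\<close>, then at \<open>i\<close>, then at 0.\<close>

lemma sum_closed_walks_marked:
  assumes S: "S \<subseteq> U"
  shows "(\<Sum>f\<in>PiE {..i + l + d} (\<lambda>_. U). walk_weight W (i + l + d) f * W (f (i + l + d)) (f 0)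
            * of_bool (f i \<in> S) * of_bool (f (i + l) \<in> S))
       = pair_sum U W S l (Suc (i + d))"
proof -
  let ?M = "kpow U W"
  have marked: "(\<Sum>b\<in>U. F b * (of_bool (b \<in> S) * G b)) = (\<Sum>b\<in>S. F b * G b)" for F G :: "'b \<Rightarrow> real"
  proof -
    have "(\<Sum>b\<in>U. F b * (of_bool (b \<in> S) * G b)) = (\<Sum>b\<in>U. if b \<in> S then F b * G b else 0)"
      by (intro sum.cong) auto
    also have "\<dots> = (\<Sum>b\<in>U \<inter> S. F b * G b)"
      using finU by (simp add: sum.inter_restrict)
    also have "U \<inter> S = S" using S by blast
    finally show ?thesis .
  qed
  \<comment> \<open>\<open>g2 a t\<close> is the weight of all ways from the second mark
    \<open>t\<close> back to the start \<open>a\<close> in \<open>d + 1\<close> steps;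
    \<open>g1 a s\<close> begins already at the first mark \<open>s\<close>.\<close>
  define g2 where "g2 a t = (\<Sum>b\<in>U. ?M d t b * W b a)" for a t
  define g1 where "g1 a s = (\<Sum>t\<in>S. ?M l s t * g2 a t)" for a s
  have "(\<Sum>f\<in>PiE {..i + l + d} (\<lambda>_. U). walk_weight W (i + l + d) f
        * (W (f (i + l + d)) (f 0) * of_bool (f i \<in> S) * of_bool (f (i + l) \<in> S)))
      = (\<Sum>f\<in>PiE {..i + l} (\<lambda>_. U). walk_weight W (i + l) f *
         (\<Sum>b\<in>U. ?M d (f (i + l)) b * (W b (f 0) * of_bool (f i \<in> S) * of_bool (f (i + l) \<in> S))))"
    by (rule sum_walks_cut[where g = "\<lambda>f b. W b (f 0) * of_bool (f i \<in> S) * of_bool (f (i + l) \<in> S)"]) simp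
  also have "\<dots> = (\<Sum>f\<in>PiE {..i + l} (\<lambda>_. U). walk_weight W (i + l) f *
         (of_bool (f i \<in> S) * (of_bool (f (i + l) \<in> S) * g2 (f 0) (f (i + l)))))"
    by (intro sum.cong refl arg_cong2[where f = "(*)"]) (simp add: g2_def)
  also have "\<dots> = (\<Sum>f\<in>PiE {..i} (\<lambda>_. U). walk_weight W i f *
         (\<Sum>b\<in>U. ?M l (f i) b * (of_bool (f i \<in> S) * (of_bool (b \<in> S) * g2 (f 0) b))))"
    by (rule sum_walks_cut[where g = "\<lambda>f b. of_bool (f i \<in> S) * (of_bool (b \<in> S) * g2 (f 0) b)"]) simp
  also have "\<dots> = (\<Sum>f\<in>PiE {..0 + i} (\<lambda>_. U). walk_weight W (0 + i) f *
         (of_bool (f (0 + i) \<in> S) * g1 (f 0) (f (0 + i))))"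
    unfolding g1_def marked[symmetric] by (simp add: sum_distrib_left mult.left_commute)
  also have "\<dots> = (\<Sum>f\<in>PiE {..0} (\<lambda>_. U). walk_weight W 0 f *
         (\<Sum>s\<in>U. ?M i (f 0) s * (of_bool (s \<in> S) * g1 (f 0) s)))"
    by (rule sum_walks_cut[where g = "\<lambda>f s. of_bool (s \<in> S) * g1 (f 0) s"]) simp
  also have "\<dots> = (\<Sum>a\<in>U. \<Sum>s\<in>S. ?M i a s * g1 a s)"
    unfolding marked by (simp add: walk_weight_def sum_PiE_atMost_0[where F = "\<lambda>a. \<Sum>s\<in>S. ?M i a s * g1 a s"] del: atMost_0)
  also have "\<dots> = (\<Sum>s\<in>S. \<Sum>a\<in>U. \<Sum>t\<in>S. ?M i a s * (?M l s t * ?M (Suc d) t a))"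
    by (subst sum.swap) (simp add: g1_def g2_def sum_distrib_left)
  also have "\<dots> = (\<Sum>s\<in>S. \<Sum>t\<in>S. \<Sum>a\<in>U. ?M i a s * (?M l s t * ?M (Suc d) t a))"
    by (rule sum.cong[OF refl], rule sum.swap)
  also have "\<dots> = (\<Sum>s\<in>S. \<Sum>t\<in>S. ?M l s t * ?M (Suc (i + d)) s t)"
  proof (intro sum.cong refl)
    fix s t assume "s \<in> S" "t \<in> S"
    then have st: "s \<in> U" "t \<in> U" using S by auto
    have "?M (i + Suc d) s t = (\<Sum>a\<in>U. ?M i a s * ?M (Suc d) t a)"
      using st unfolding kpow_add'[OF st]
      by (intro sum.cong refl arg_cong2[where f = "(*)"] kpow_sym)
    then show "(\<Sum>a\<in>U. ?M i a s * (?M l s t * ?M (Suc d) t a)) = ?M l s t * ?M (Suc (i + d)) s t"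
      by (simp add: sum_distrib_left mult.left_commute del: kpow.simps)
  qed
  finally show ?thesis by (simp add: pair_sum_def mult.assoc)
qed


text \<open>\<open>S v\<close> stands for the sets containing \<open>v\<close>, and \<epsilon>
  bounds the share of the \<open>u\<close>-mass that one step finds in \<open>S v\<close>. If no
  walk were spread, marked walks would account for all of \<open>tr W^(2k)\<close> and push it below
  1.\<close>

lemma exists_spread_closed_walk:
  fixes S :: "'v \<Rightarrow> 'b set"
  assumes k: "2 \<le> k" and finV: "finite V" and S: "\<And>v. v \<in> V \<Longrightarrow> S v \<subseteq> U" and ne: "U \<noteq> {}"
    and upos: "\<And>x. x \<in> U \<Longrightarrow> 0 < u x"
    and eig: "\<And>x. x \<in> U \<Longrightarrow> (\<Sum>y\<in>U. W x y * u y) = u x"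
    and eps: "\<And>v z. v \<in> V \<Longrightarrow> z \<in> U \<Longrightarrow> (\<Sum>y\<in>S v. W z y * u y) \<le> \<epsilon> * u z" and eps0: "0 \<le> \<epsilon>"
    and few: "\<And>x. x \<in> U \<Longrightarrow> card {v\<in>V. x \<in> S v} \<le> r"
    and disj: "\<And>v x y. v \<in> V \<Longrightarrow> x \<in> S v \<Longrightarrow> y \<in> S v \<Longrightarrow> W x y = 0"
    and tr: "(\<Sum>x\<in>U. \<Sum>y\<in>U. (W x y)\<^sup>2) \<le> \<tau>"
    and small: "(4 * real k ^ 2 * real r * \<epsilon>) ^ (k - 1) * \<tau> < 1"
  obtains f where "\<And>i. i < 2 * k \<Longrightarrow> f i \<in> U"
    and "\<And>i. i < 2 * k \<Longrightarrow> W (f i) (f (Suc i mod (2 * k))) \<noteq> 0"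
    and "\<And>i j v. i < j \<Longrightarrow> j < 2 * k \<Longrightarrow> v \<in> V \<Longrightarrow> f i \<in> S v \<Longrightarrow> f j \<notin> S v"
proof (rule ccontr)
  assume no: "\<not> thesis"
  note found = that
  define m where "m = 2 * k - 1"
  have m: "Suc m = 2 * k" using k by (simp add: m_def)
  let ?T = "even_trace U W"
  define wc where "wc f = walk_weight W m f * W (f m) (f 0)" for f
  \<comment> \<open>Pairs of positions with the later one first.\<close>
  define P where "P = (SIGMA j:{..m}. {..<j})"
  define bad where "bad f p v = wc f * of_bool (f (snd p) \<in> S v) * of_bool (f (fst p) \<in> S v)" for f p v
  have wc_nonneg: "0 \<le> wc f" for f
    unfolding wc_def walk_weight_def by (intro mult_nonneg_nonneg prod_nonneg W_nonneg ballI)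
  have bad_nonneg: "0 \<le> bad f p v" for f p v
    unfolding bad_def by (intro mult_nonneg_nonneg wc_nonneg) auto
  have finP: "finite P" by (simp add: P_def)
  have wc_le: "wc f \<le> (\<Sum>p\<in>P. \<Sum>v\<in>V. bad f p v)" if f: "f \<in> PiE {..m} (\<lambda>_. U)" for f
  proof (cases "wc f = 0")
    case True
    then show ?thesis by (simp add: sum_nonneg bad_nonneg)
  next
    case False
    have fU: "f i \<in> U" if "i < 2 * k" for i
      using f that m by (auto simp: PiE_def Pi_def)
    have fW: "W (f i) (f (Suc i mod (2 * k))) \<noteq> 0" if "i < 2 * k" for i
    proof (cases "i = m")
      case True
      then show ?thesis using False m by (simp add: wc_def)
    next
      case ne: False
      then have "i < m" using that m by simp
      moreover from this have "Suc i mod (2 * k) = Suc i" using m by simp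
      ultimately show ?thesis using False by (auto simp: wc_def walk_weight_def)
    qed
    have "\<exists>i j v. i < j \<and> j < 2 * k \<and> v \<in> V \<and> f i \<in> S v \<and> f j \<in> S v"
    proof (rule ccontr)
      assume "\<not> ?thesis"
      then have "f j \<notin> S v" if "i < j" "j < 2 * k" "v \<in> V" "f i \<in> S v" for i j v
        using that by blast
      from found[of f, OF fU fW this] no show False by simp
    qed
    then obtain i j v where ij: "i < j" "j < 2 * k" "v \<in> V" "f i \<in> S v" "f j \<in> S v"
      by blast
    then have p: "(j, i) \<in> P" using m by (auto simp: P_def)
    have "wc f = bad f (j, i) v" using ij by (simp add: bad_def)
    also have "\<dots> \<le> (\<Sum>v\<in>V. bad f (j, i) v)"
      by (rule member_le_sum) (use ij finV bad_nonneg in auto)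
    also have "\<dots> \<le> (\<Sum>p\<in>P. \<Sum>v\<in>V. bad f p v)"
      by (rule member_le_sum[where f = "\<lambda>p. \<Sum>v\<in>V. bad f p v"]) (use p finP in \<open>auto intro: sum_nonneg bad_nonneg\<close>)
    finally show ?thesis .
  qed
  have bad_le: "(\<Sum>f\<in>PiE {..m} (\<lambda>_. U). bad f p v) \<le> pair_sum U W (S v) 2 (2 * k - 2)"
    if p: "p \<in> P" and v: "v \<in> V" for p v
  proof -
    obtain j i where ji: "p = (j, i)" "i < j" "j \<le> m" using p by (auto simp: P_def)
    define l where "l = j - i"
    define d where "d = m - j"
    have e: "j = i + l" "m = i + l + d" "Suc (i + d) = 2 * k - l"
      using ji m by (auto simp: l_def d_def)
    have "(\<Sum>f\<in>PiE {..m} (\<lambda>_. U). bad f p v) = pair_sum U W (S v) l (2 * k - l)"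
      using sum_closed_walks_marked[OF S[OF v], of i l d]
      by (simp add: bad_def wc_def ji(1) e(1) e(2)[symmetric] e(3)[symmetric])
    \<comment> \<open>An arc of length 1 joins cyclically neighbouring positions, where
      \<open>disj\<close> makes the sum vanish. The other lengths are exactly those covered by
      \<open>pair_sum_le_end\<close>.\<close>
    also have "\<dots> \<le> pair_sum U W (S v) 2 (2 * k - 2)"
    proof (cases "l = 1 \<or> 2 * k - l = 1")
      case True
      have one: "kpow U W 1 s t = 0" if "s \<in> S v" "t \<in> S v" for s t
        using disj[OF v that] S[OF v] that by (simp add: kpow_Suc_0 subset_iff del: kpow.simps)
      have "pair_sum U W (S v) l (2 * k - l) = 0"
        unfolding pair_sum_def using True by (intro sum.neutral ballI) (auto simp: one simp del: kpow.simps One_nat_def)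
      then show ?thesis by (simp add: pair_sum_nonneg)
    next
      case False
      then have "2 \<le> l" "l + 2 \<le> 2 * k"
        using e(1,2) ji(2) m by linarith+
      then show ?thesis by (intro pair_sum_le_end[OF S[OF v]] k)
    qed
    finally show ?thesis .
  qed
  \<comment> \<open>After exchanging the sums, the diagonal entry at \<open>x\<close> is counted
    once for every \<open>v\<close> with \<open>x\<close> in \<open>S v\<close>, so at most
    \<open>r\<close> times.\<close>
  have sum_v: "(\<Sum>v\<in>V. pair_sum U W (S v) 2 (2 * k - 2)) \<le> \<epsilon> * (real r * ?T (k - 1))"
  proof -
    let ?D = "\<lambda>x. kpow U W (2 * (k - 1)) x x"
    have "(\<Sum>v\<in>V. pair_sum U W (S v) 2 (2 * (k - 1))) \<le> (\<Sum>v\<in>V. \<epsilon> * (\<Sum>x\<in>S v. ?D x))"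
      by (intro sum_mono pair_sum_two_le[where u = u] S upos eig eps) auto
    also have "\<dots> = \<epsilon> * (\<Sum>v\<in>V. \<Sum>x\<in>{x\<in>U. x \<in> S v}. ?D x)"
      unfolding sum_distrib_left by (intro sum.cong refl) (use S in auto)
    also have "(\<Sum>v\<in>V. \<Sum>x\<in>{x\<in>U. x \<in> S v}. ?D x) = (\<Sum>x\<in>U. \<Sum>v\<in>{v\<in>V. x \<in> S v}. ?D x)"
      by (rule sum.swap_restrict[OF finV finU])
    also have "\<dots> \<le> (\<Sum>x\<in>U. real r * ?D x)"
      by (intro sum_mono) (simp add: mult_right_mono few kpow_nonneg)
    finally show ?thesis using eps0
      by (simp add: even_trace_def sum_distrib_left right_diff_distrib' mult_left_mono)
  qed
  define c where "c = 4 * real k ^ 2 * real r * \<epsilon>"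
  have c0: "0 \<le> c" using eps0 by (simp add: c_def)
  have "?T k = (\<Sum>f\<in>PiE {..m} (\<lambda>_. U). wc f)"
    using sum_closed_walks[of m] by (simp add: even_trace_def wc_def m del: kpow.simps)
  also have "\<dots> \<le> (\<Sum>f\<in>PiE {..m} (\<lambda>_. U). \<Sum>p\<in>P. \<Sum>v\<in>V. bad f p v)"
    by (intro sum_mono wc_le)
  also have "\<dots> = (\<Sum>p\<in>P. \<Sum>v\<in>V. \<Sum>f\<in>PiE {..m} (\<lambda>_. U). bad f p v)"
    by (subst sum.swap, rule sum.cong[OF refl], rule sum.swap)
  also have "\<dots> \<le> (\<Sum>p\<in>P. \<Sum>v\<in>V. pair_sum U W (S v) 2 (2 * k - 2))"
    by (intro sum_mono bad_le)
  also have "\<dots> \<le> (\<Sum>p\<in>P. \<epsilon> * (real r * ?T (k - 1)))"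
    by (intro sum_mono sum_v)
  also have "\<dots> = real (card P) * (\<epsilon> * (real r * ?T (k - 1)))" by simp
  also have "\<dots> \<le> real (4 * k ^ 2) * (\<epsilon> * (real r * ?T (k - 1)))"
  proof (rule mult_right_mono)
    have "P \<subseteq> {..<2 * k} \<times> {..<2 * k}" using m by (auto simp: P_def)
    then have "card P \<le> card ({..<2 * k} \<times> {..<2 * k})" by (intro card_mono) auto
    then show "real (card P) \<le> real (4 * k ^ 2)"
      unfolding of_nat_le_iff by (simp add: power2_eq_square)
  qed (intro mult_nonneg_nonneg eps0 even_trace_nonneg, simp)
  finally have top: "?T k \<le> c * ?T (k - 1)" by (simp add: c_def mult_ac)
  have T1: "1 \<le> ?T n" for n
    by (rule even_trace_ge_1[OF eig upos ne])
  \<comment> \<open>By log-convexity the quotients of consecutive even traces are nondecreasing, so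
    the bound \<open>c\<close> at the top passes down to all smaller exponents.\<close>
  have step: "?T (k - n) \<le> c * ?T (k - n - 1)" if "n < k" for n
    using that
  proof (induction n)
    case 0
    then show ?case using top by simp
  next
    case (Suc n)
    define q where "q = k - Suc n - 1"
    have q: "k - Suc n = Suc q" "k - n = Suc (Suc q)" "k - n - 1 = Suc q"
      using Suc.prems by (auto simp: q_def)
    have "?T (Suc q) * ?T (Suc q) \<le> ?T q * ?T (Suc (Suc q))"
      using even_trace_log_convex[of q] by (simp add: power2_eq_square)
    also have "\<dots> \<le> ?T q * (c * ?T (Suc q))"
      using Suc q by (intro mult_left_mono even_trace_nonneg) auto
    finally have "?T (Suc q) * ?T (Suc q) \<le> (c * ?T q) * ?T (Suc q)" by (simp add: mult_ac)
    then have "?T (Suc q) \<le> c * ?T q" using T1[of "Suc q"] by (simp add: mult_le_cancel_right)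
    then show ?case using q by (simp add: q_def[symmetric])
  qed
  have "?T k \<le> c ^ n * ?T (k - n)" if "n \<le> k" for n
    using that
  proof (induction n)
    case (Suc n)
    have "?T k \<le> c ^ n * ?T (k - n)" using Suc by simp
    also have "\<dots> \<le> c ^ n * (c * ?T (k - n - 1))"
      using Suc.prems c0 by (intro mult_left_mono step) auto
    finally show ?case by (simp add: mult_ac)
  qed simp
  \<comment> \<open>The descent stops at \<open>tr W^2\<close>, where the bound \<tau> is
    available.\<close>
  from this[of "k - 1"] have "?T k \<le> c ^ (k - 1) * ?T 1" using k by simp
  also have "?T 1 = (\<Sum>x\<in>U. \<Sum>y\<in>U. (W x y)\<^sup>2)"
    unfolding even_trace_eq by (intro sum.cong refl) (simp add: kpow_Suc_0 del: kpow.simps)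
  also have "c ^ (k - 1) * \<dots> \<le> c ^ (k - 1) * \<tau>"
    using tr c0 by (intro mult_left_mono) auto
  also have "\<dots> < 1" using small by (simp add: c_def)
  finally show False using T1[of k] by simp
qed

end

subsection \<open>The graph of completely joined sets\<close>

text \<open>Deleting a vertex \<open>x\<close> of degree below \<open>t x\<close> lowers the degree
  sum by less than \<open>2 * t x\<close>, so the strict inequality survives. It fails for the empty
  set, hence the deletion stops before that. The thresholds stay fixed throughout.\<close>

lemma prune_to_min_degree:
  fixes adj :: "'b \<Rightarrow> 'b \<Rightarrow> bool" and t :: "'b \<Rightarrow> real"
  assumes "finite U0" and sym: "\<And>x y. adj x y \<Longrightarrow> adj y x" and irrefl: "\<And>x. x \<in> U0 \<Longrightarrow> \<not> adj x x"
    and "2 * (\<Sum>x\<in>U0. t x) < (\<Sum>x\<in>U0. real (card {y\<in>U0. adj x y}))"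
  shows "\<exists>U\<subseteq>U0. U \<noteq> {} \<and> (\<forall>x\<in>U. t x \<le> real (card {y\<in>U. adj x y}))"
  using assms(1,3,4)
proof (induction U0 rule: finite_psubset_induct)
  case (psubset U0)
  have card_eq: "real (card {y\<in>A. adj x y}) = (\<Sum>y\<in>A. of_bool (adj x y))" if "A \<subseteq> U0" for x A
  proof -
    have "finite A" using that psubset.hyps finite_subset by blast
    then show ?thesis by (simp add: Int_def)
  qed
  show ?case
  proof (cases "\<forall>x\<in>U0. t x \<le> real (card {y\<in>U0. adj x y})")
    case True
    have "U0 \<noteq> {}" using psubset.prems(2) by auto
    then show ?thesis using True by blast
  next
    case False
    then obtain x where x: "x \<in> U0" "real (card {y\<in>U0. adj x y}) < t x" by force
    define A where "A = U0 - {x}"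
    have A: "U0 = insert x A" "x \<notin> A" "finite A" "A \<subset> U0" "A \<subseteq> U0"
      using x psubset.hyps by (auto simp: A_def)
    define g :: "'b \<Rightarrow> 'b \<Rightarrow> real" where "g y z = of_bool (adj y z)" for y z
    have g: "g x x = 0" "g y x = g x y" for y
      using psubset.prems(1)[OF x(1)] sym[of x y] sym[of y x] by (auto simp: g_def)
    have ins: "(\<Sum>y\<in>U0. F y) = F x + (\<Sum>y\<in>A. F y)" for F :: "'b \<Rightarrow> real"
      using A(2,3) unfolding A(1) by simp
    have "(\<Sum>y\<in>U0. real (card {z\<in>U0. adj y z})) = (\<Sum>y\<in>U0. \<Sum>z\<in>U0. g y z)"
      by (simp only: card_eq[OF order_refl] g_def)
    also have "\<dots> = 2 * (\<Sum>y\<in>A. g x y) + (\<Sum>y\<in>A. \<Sum>z\<in>A. g y z)"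
    proof -
      have "(\<Sum>y\<in>A. g y x) = (\<Sum>y\<in>A. g x y)" by (intro sum.cong refl g(2))
      then show ?thesis by (simp add: ins sum.distrib g(1))
    qed
    also have "(\<Sum>y\<in>A. g x y) = (\<Sum>y\<in>U0. g x y)"
      by (simp only: ins g(1) add_0)
    also have "\<dots> = real (card {y\<in>U0. adj x y})"
      by (simp only: card_eq[OF order_refl] g_def)
    also have "(\<Sum>y\<in>A. \<Sum>z\<in>A. g y z) = (\<Sum>y\<in>A. real (card {z\<in>A. adj y z}))"
      by (simp only: card_eq[OF A(5)] g_def)
    finally have "2 * (\<Sum>x\<in>U0. t x) < 2 * t x + (\<Sum>y\<in>A. real (card {z\<in>A. adj y z}))"
      using psubset.prems(2) x(2) by linarith
    then have "2 * (\<Sum>x\<in>A. t x) < (\<Sum>y\<in>A. real (card {z\<in>A. adj y z}))"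
      by (simp add: ins)
    then have "\<exists>U\<subseteq>A. U \<noteq> {} \<and> (\<forall>x\<in>U. t x \<le> real (card {y\<in>U. adj x y}))"
      by (intro psubset.IH[OF A(4)] psubset.prems(1)) (simp_all add: subsetD[OF A(5)])
    then show ?thesis using A(5) by (elim exE conjE) (intro exI conjI, auto)
  qed
qed

lemma binomial_le_power: "n choose r \<le> n ^ r"
  by (cases "r \<le> n") (auto simp: binomial_le_pow binomial_eq_0)

text \<open>Adjacency in the auxiliary graph. In a loopless graph it forces \<open>x\<close> and
  \<open>y\<close> to be disjoint.\<close>

definition completely_joined :: "'a set set \<Rightarrow> 'a set \<Rightarrow> 'a set \<Rightarrow> bool" where
  "completely_joined E x y \<longleftrightarrow> (\<forall>u\<in>x. \<forall>v\<in>y. {u, v} \<in> E)"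

definition common_nbrs :: "'a set \<Rightarrow> 'a set set \<Rightarrow> 'a set \<Rightarrow> 'a set" where
  "common_nbrs V E z = {v\<in>V. \<forall>u\<in>z. {u, v} \<in> E}"

lemma completely_joined_sym: "completely_joined E x y \<Longrightarrow> completely_joined E y x"
  unfolding completely_joined_def by (metis insert_commute)

text \<open>The blowup vertex \<open>(i, a)\<close> goes to the \<open>a\<close>-th element of
  \<open>f i\<close> in some enumeration; disjointness of the classes makes this injective.\<close>

lemma contains_blowup_cycle:
  assumes m: "2 \<le> m"
    and sub: "\<And>i. i < m \<Longrightarrow> f i \<subseteq> V" and card: "\<And>i. i < m \<Longrightarrow> card (f i) = r"
    and fin: "finite V"
    and joined: "\<And>i. i < m \<Longrightarrow> completely_joined E (f i) (f (Suc i mod m))"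
    and disj: "\<And>i j. i < j \<Longrightarrow> j < m \<Longrightarrow> f i \<inter> f j = {}"
  shows "contains_copy V E (blowup_V (cycle_V m) r) (blowup_E (cycle_E m) r)"
proof -
  have "\<exists>b. bij_betw b {0..<r} (f i)" if "i < m" for i
    using ex_bij_betw_nat_finite[of "f i"] card[OF that] finite_subset[OF sub[OF that] fin] by auto
  then obtain b where b: "\<And>i. i < m \<Longrightarrow> bij_betw (b i) {0..<r} (f i)" by metis
  have b_in: "b i a \<in> f i" if "i < m" "a < r" for i a
    using bij_betwE[OF b[OF that(1)]] that(2) by auto
  define \<phi> where "\<phi> p = b (fst p) (snd p)" for p
  have "inj_on \<phi> (blowup_V (cycle_V m) r)"
  proof (rule inj_onI)
    fix p q assume pq: "p \<in> blowup_V (cycle_V m) r" "q \<in> blowup_V (cycle_V m) r" "\<phi> p = \<phi> q"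
    obtain i a j c where p: "p = (i, a)" "q = (j, c)" by (cases p, cases q)
    have lt: "i < m" "j < m" "a < r" "c < r" using pq p by (auto simp: blowup_V_def cycle_V_def)
    have eq: "b i a = b j c" using pq p by (simp add: \<phi>_def)
    have "i = j"
    proof (rule ccontr)
      assume "i \<noteq> j"
      then have "f i \<inter> f j = {}" using disj[of i j] disj[of j i] lt by (cases "i < j") auto
      then show False using b_in[of i a] b_in[of j c] lt eq by auto
    qed
    moreover from this have "a = c"
      using b[OF lt(1)] eq lt by (auto simp: bij_betw_def inj_on_def)
    ultimately show "p = q" using p by simp
  qed
  moreover have "\<phi> ` blowup_V (cycle_V m) r \<subseteq> V"
    using b_in sub by (auto simp: blowup_V_def cycle_V_def \<phi>_def subset_iff)
  moreover have "\<phi> ` e \<in> E" if "e \<in> blowup_E (cycle_E m) r" for e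
  proof -
    obtain u v i j where e: "e = {(u, i), (v, j)}" "{u, v} \<in> cycle_E m" "i < r" "j < r"
      using \<open>e \<in> blowup_E (cycle_E m) r\<close> unfolding blowup_E_def by blast
    then obtain l where l: "l < m" "{u, v} = {l, (l + 1) mod m}" by (auto simp: cycle_E_def)
    have l': "Suc l mod m < m" using m by simp
    \<comment> \<open>A cycle edge is an unordered pair, so either \<open>u\<close> or
      \<open>v\<close> may be the earlier endpoint.\<close>
    consider "u = l" "v = Suc l mod m" | "v = l" "u = Suc l mod m"
      using l(2) by (auto simp: doubleton_eq_iff)
    then have "{b u i, b v j} \<in> E"
    proof cases
      case 1
      then show ?thesis
        using joined[OF l(1)] b_in[OF l(1) e(3)] b_in[OF l' e(4)] by (auto simp: completely_joined_def)
    next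
      case 2
      then show ?thesis
        using joined[OF l(1)] b_in[OF l(1) e(4)] b_in[OF l' e(3)]
        by (auto simp: completely_joined_def insert_commute)
    qed
    then show ?thesis by (simp add: e(1) \<phi>_def)
  qed
  ultimately show ?thesis unfolding contains_copy_def by blast
qed

text \<open>Deleting \<open>v\<close> injects these sets into the \<open>(r-1)\<close>-subsets of
  \<open>A\<close>.\<close>

lemma card_subsets_containing_le:
  assumes "finite A" "1 \<le> r"
  shows "card {y. y \<subseteq> A \<and> card y = r \<and> v \<in> y} \<le> card A ^ (r - 1)"
proof -
  have "card {y. y \<subseteq> A \<and> card y = r \<and> v \<in> y} \<le> card {y. y \<subseteq> A \<and> card y = r - 1}"
  proof (rule card_inj_on_le[where f = "\<lambda>y. y - {v}"])
    show "inj_on (\<lambda>y. y - {v}) {y. y \<subseteq> A \<and> card y = r \<and> v \<in> y}"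
      by (rule inj_onI) blast
    show "(\<lambda>y. y - {v}) ` {y. y \<subseteq> A \<and> card y = r \<and> v \<in> y} \<subseteq> {y. y \<subseteq> A \<and> card y = r - 1}"
      using assms by auto
    show "finite {y. y \<subseteq> A \<and> card y = r - 1}" using assms by simp
  qed
  also have "\<dots> = card A choose (r - 1)" using assms by (simp add: n_subsets)
  also have "\<dots> \<le> card A ^ (r - 1)" by (rule binomial_le_power)
  finally show ?thesis .
qed

text \<open>The right side of \<open>many\<close> is the degree sum of the auxiliary graph, so
  pruning applies. In the threshold, the first term ensures that the neighbours through one vertex
  are at most a fraction \<open>1 / \<delta>\<close> of all neighbours; the second one bounds
  \<open>tr W^2\<close>.\<close>

lemma contains_blowup_if_many_joined_pairs:
  fixes V :: "'a set" and \<delta> :: real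
  assumes fin: "finite V" and graph: "is_graph V E" and r: "1 \<le> r" and k: "2 \<le> k" and \<delta>: "0 < \<delta>"
    and many: "2 * (\<Sum>z | z \<subseteq> V \<and> card z = r. \<delta> * real (card (common_nbrs V E z)) ^ (r - 1) + \<delta> ^ r)
      < (\<Sum>z | z \<subseteq> V \<and> card z = r. real (card (common_nbrs V E z) choose r))"
    and large: "(4 * real k ^ 2 * real r) ^ (k - 1) * real (card V) ^ r < \<delta> ^ (k + r - 1)"
  shows "contains_copy V E (blowup_V (cycle_V (2 * k)) r) (blowup_E (cycle_E (2 * k)) r)"
proof -
  let ?adj = "completely_joined E"
  define U0 where "U0 = {z. z \<subseteq> V \<and> card z = r}"
  define d where "d z = card (common_nbrs V E z)" for z
  define t where "t z = \<delta> * real (d z) ^ (r - 1) + \<delta> ^ r" for z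
  have finU0: "finite U0" using fin by (simp add: U0_def)
  have loopless: "{v, v} \<notin> E" for v using graph by (auto simp: is_graph_def)
  have irrefl: "\<not> ?adj x y" if "v \<in> x" "v \<in> y" for x y v
    using that loopless[of v] unfolding completely_joined_def by blast
  have nonempty: "\<exists>v. v \<in> x" if "x \<in> U0" for x
    using that r by (cases "x = {}") (auto simp: U0_def)
  have nbr_sub: "y \<subseteq> common_nbrs V E x" if "y \<in> U0" "?adj x y" for x y
    using that by (auto simp: completely_joined_def common_nbrs_def U0_def)
  have finC: "finite (common_nbrs V E z)" for z using fin by (simp add: common_nbrs_def)
  have deg0: "card {y\<in>U0. ?adj x y} = d x choose r" for x
  proof -
    have "{y\<in>U0. ?adj x y} = {y. y \<subseteq> common_nbrs V E x \<and> card y = r}"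
      by (auto simp: U0_def completely_joined_def common_nbrs_def)
    then show ?thesis using n_subsets[OF finC] by (simp add: d_def)
  qed
  have "2 * (\<Sum>x\<in>U0. t x) < (\<Sum>x\<in>U0. real (card {y\<in>U0. ?adj x y}))"
    using many unfolding deg0 unfolding t_def d_def U0_def by simp
  then have "\<exists>U\<subseteq>U0. U \<noteq> {} \<and> (\<forall>x\<in>U. t x \<le> real (card {y\<in>U. ?adj x y}))"
    using nonempty irrefl by (intro prune_to_min_degree[OF finU0 completely_joined_sym]) blast+
  then obtain U where U: "U \<subseteq> U0" "U \<noteq> {}"
    and min_deg: "\<And>x. x \<in> U \<Longrightarrow> t x \<le> real (card {y\<in>U. ?adj x y})"
    by blast
  have finU: "finite U" using U finU0 finite_subset by blast
  \<comment> \<open>Degrees are counted inside \<open>U\<close>, so that \<open>W\<close> fixes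
    \<open>sqrt h\<close> exactly; \<open>d\<close> still counts in all of \<open>V\<close>.\<close>
  define h where "h x = real (card {y\<in>U. ?adj x y})" for x
  have h_sum: "(\<Sum>y\<in>U. of_bool (?adj x y)) = h x" for x
    using finU by (simp add: h_def Int_def)
  have h_ge: "\<delta> * real (d x) ^ (r - 1) \<le> h x" "\<delta> ^ r \<le> h x" if "x \<in> U" for x
    using min_deg[OF that] \<delta> unfolding t_def h_def
    by (smt (verit) mult_nonneg_nonneg of_nat_0_le_iff zero_le_power)+
  have h_pos: "0 < h x" if "x \<in> U" for x
    using h_ge(2)[OF that] \<delta> by (smt (verit) zero_less_power)
  define W where "W x y = of_bool (x \<in> U \<and> y \<in> U \<and> ?adj x y) / (sqrt (h x) * sqrt (h y))" for x y
  interpret sym_kernel U W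
  proof
    show "W x y = W y x" for x y
      unfolding W_def using completely_joined_sym[of E x y] completely_joined_sym[of E y x]
      by (auto simp: mult.commute)
    show "0 \<le> W x y" for x y by (simp add: W_def h_def)
  qed (rule finU)
  define S where "S v = {x\<in>U. v \<in> x}" for v
  have W_u: "W x y * sqrt (h y) = of_bool (?adj x y) / sqrt (h x)" if "x \<in> U" "y \<in> U" for x y
    using that h_pos[OF that(2)] by (simp add: W_def)
  have eig: "(\<Sum>y\<in>U. W x y * sqrt (h y)) = sqrt (h x)" if "x \<in> U" for x
  proof -
    have "(\<Sum>y\<in>U. W x y * sqrt (h y)) = (\<Sum>y\<in>U. of_bool (?adj x y)) / sqrt (h x)"
      using W_u[OF that] by (simp add: sum_divide_distrib del: sum_of_bool_eq)
    then show ?thesis using h_pos[OF that] by (simp add: h_sum real_div_sqrt)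
  qed
  have eps: "(\<Sum>y\<in>S v. W z y * sqrt (h y)) \<le> 1 / \<delta> * sqrt (h z)" if z: "z \<in> U" for v z
  proof -
    have S_U: "S v \<subseteq> U" and finS: "finite (S v)" using finU by (auto simp: S_def)
    have "(\<Sum>y\<in>S v. W z y * sqrt (h y)) = (\<Sum>y\<in>S v. of_bool (?adj z y)) / sqrt (h z)"
      unfolding sum_divide_distrib by (intro sum.cong refl W_u z) (use S_U in auto)
    also have "(\<Sum>y\<in>S v. of_bool (?adj z y)) = real (card {y\<in>S v. ?adj z y})"
      using finS by (simp add: Int_def)
    finally have row: "(\<Sum>y\<in>S v. W z y * sqrt (h y)) = real (card {y\<in>S v. ?adj z y}) / sqrt (h z)" .
    have "{y\<in>S v. ?adj z y} \<subseteq> {y. y \<subseteq> common_nbrs V E z \<and> card y = r \<and> v \<in> y}"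
    proof
      fix y assume "y \<in> {y\<in>S v. ?adj z y}"
      then have "y \<in> U0" "?adj z y" "v \<in> y" using U(1) by (auto simp: S_def)
      then show "y \<in> {y. y \<subseteq> common_nbrs V E z \<and> card y = r \<and> v \<in> y}"
        using nbr_sub[of y z] by (simp add: U0_def)
    qed
    moreover have "finite {y. y \<subseteq> common_nbrs V E z \<and> card y = r \<and> v \<in> y}"
      by (rule finite_subset[of _ "Pow (common_nbrs V E z)"]) (auto simp: finC)
    ultimately have "card {y\<in>S v. ?adj z y} \<le> card {y. y \<subseteq> common_nbrs V E z \<and> card y = r \<and> v \<in> y}"
      by (intro card_mono)
    also have "\<dots> \<le> d z ^ (r - 1)"
      unfolding d_def by (rule card_subsets_containing_le[OF finC r])
    finally have "real (card {y\<in>S v. ?adj z y}) \<le> real (d z) ^ (r - 1)"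
      by (simp flip: of_nat_power)
    also have "\<dots> \<le> h z / \<delta>"
      using h_ge(1)[OF z] \<delta> by (simp add: pos_le_divide_eq mult.commute)
    finally have "real (card {y\<in>S v. ?adj z y}) / sqrt (h z) \<le> (h z / \<delta>) / sqrt (h z)"
      using h_pos[OF z] by (intro divide_right_mono) auto
    also have "\<dots> = 1 / \<delta> * (h z / sqrt (h z))" by simp
    also have "h z / sqrt (h z) = sqrt (h z)"
      using h_pos[OF z] by (intro real_div_sqrt) simp
    finally show ?thesis by (simp only: row)
  qed
  \<comment> \<open>Replacing \<open>h y\<close> by its lower bound \<open>\<delta> ^ r\<close>
    leaves \<open>h x\<close> neighbours of weight \<open>1 / (h x * \<delta> ^ r)\<close>, so each
    row contributes at most \<open>1 / \<delta> ^ r\<close>.\<close>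
  have tr: "(\<Sum>x\<in>U. \<Sum>y\<in>U. (W x y)\<^sup>2) \<le> real (card V) ^ r / \<delta> ^ r"
  proof -
    have "(\<Sum>x\<in>U. \<Sum>y\<in>U. (W x y)\<^sup>2) \<le> (\<Sum>x\<in>U. 1 / \<delta> ^ r)"
    proof (rule sum_mono)
      fix x assume x: "x \<in> U"
      have "(\<Sum>y\<in>U. (W x y)\<^sup>2) \<le> (\<Sum>y\<in>U. of_bool (?adj x y) / (h x * \<delta> ^ r))"
      proof (rule sum_mono)
        fix y assume y: "y \<in> U"
        have "(W x y)\<^sup>2 = of_bool (?adj x y) / (h x * h y)"
          using x y h_pos by (simp add: W_def power_divide power_mult_distrib less_imp_le)
        also have "\<dots> \<le> of_bool (?adj x y) / (h x * \<delta> ^ r)"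
          using h_pos[OF x] h_ge(2)[OF y] \<delta> by (intro divide_left_mono mult_left_mono) (auto intro!: mult_pos_pos h_pos y)
        finally show "(W x y)\<^sup>2 \<le> of_bool (?adj x y) / (h x * \<delta> ^ r)" .
      qed
      also have "\<dots> = h x / (h x * \<delta> ^ r)"
        by (simp add: sum_divide_distrib[symmetric] h_sum del: sum_of_bool_eq)
      also have "\<dots> = 1 / \<delta> ^ r" using h_pos[OF x] by simp
      finally show "(\<Sum>y\<in>U. (W x y)\<^sup>2) \<le> 1 / \<delta> ^ r" .
    qed
    also have "\<dots> = real (card U) / \<delta> ^ r" by simp
    also have "\<dots> \<le> real (card V) ^ r / \<delta> ^ r"
    proof (rule divide_right_mono)
      have "card U \<le> card U0" using U finU0 by (intro card_mono) auto
      also have "\<dots> = card V choose r" using fin by (simp add: U0_def n_subsets)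
      also have "\<dots> \<le> card V ^ r" by (rule binomial_le_power)
      finally show "real (card U) \<le> real (card V) ^ r"
        by (simp flip: of_nat_power)
    qed (use \<delta> in simp)
    finally show ?thesis .
  qed
  \<comment> \<open>The exponent \<open>k + r - 1\<close> arises from \<open>k - 1\<close> factors
    \<open>1 / \<delta>\<close> in the descent and \<open>r\<close> in the bound for
    \<open>tr W^2\<close>.\<close>
  have small: "(4 * real k ^ 2 * real r * (1 / \<delta>)) ^ (k - 1) * (real (card V) ^ r / \<delta> ^ r) < 1"
  proof -
    have "(4 * real k ^ 2 * real r * (1 / \<delta>)) ^ (k - 1) * (real (card V) ^ r / \<delta> ^ r)
        = (4 * real k ^ 2 * real r) ^ (k - 1) * real (card V) ^ r / \<delta> ^ ((k - 1) + r)"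
      unfolding power_add by (simp add: power_divide)
    also have "(k - 1) + r = k + r - 1" using k by simp
    finally show ?thesis using large \<delta> by simp
  qed
  show ?thesis
  proof (rule exists_spread_closed_walk[where V = V and S = S and u = "\<lambda>x. sqrt (h x)" and \<epsilon> = "1 / \<delta>"
        and r = r, OF k fin _ U(2) _ eig eps _ _ _ tr small])
    fix x assume x: "x \<in> U"
    then have "x \<subseteq> V" "card x = r" using U by (auto simp: U0_def)
    moreover have "{v\<in>V. x \<in> S v} = x" using x \<open>x \<subseteq> V\<close> by (auto simp: S_def)
    ultimately show "card {v\<in>V. x \<in> S v} \<le> r" by simp
  next
    fix f assume f: "\<And>i. i < 2 * k \<Longrightarrow> f i \<in> U"
      "\<And>i. i < 2 * k \<Longrightarrow> W (f i) (f (Suc i mod (2 * k))) \<noteq> 0"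
      "\<And>i j v. i < j \<Longrightarrow> j < 2 * k \<Longrightarrow> v \<in> V \<Longrightarrow> f i \<in> S v \<Longrightarrow> f j \<notin> S v"
    have fU0: "f i \<subseteq> V" "card (f i) = r" if "i < 2 * k" for i
      using f(1)[OF that] U by (auto simp: U0_def)
    show ?thesis
    proof (rule contains_blowup_cycle[where f = f])
      fix i assume "i < 2 * k"
      from f(2)[OF this] show "?adj (f i) (f (Suc i mod (2 * k)))"
        by (auto simp: W_def)
    next
      fix i j assume ij: "i < j" "j < 2 * k"
      show "f i \<inter> f j = {}"
      proof (rule ccontr)
        assume "f i \<inter> f j \<noteq> {}"
        then obtain v where v: "v \<in> f i" "v \<in> f j" by blast
        then have "v \<in> V" using fU0(1)[OF ij(2)] by auto
        then show False using f(3)[OF ij, of v] f(1)[of i] f(1)[of j] v ij by (auto simp: S_def)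
      qed
    qed (use k fin fU0 in auto)
  qed (use h_pos \<delta> irrefl in \<open>auto simp: S_def W_def\<close>)
qed

subsection \<open>Counting\<close>

text \<open>A power mean inequality that gives up a factor 2 in the mean and so follows termwise
  from \<open>a * c^(r-1) - c^r <= a^r\<close>.\<close>

lemma sum_power_ge:
  fixes x :: "'i \<Rightarrow> real"
  assumes r: "1 \<le> r" and nonneg: "\<And>i. i \<in> I \<Longrightarrow> 0 \<le> x i" and c: "0 \<le> c"
    and mean: "2 * real (card I) * c \<le> (\<Sum>i\<in>I. x i)"
  shows "real (card I) * c ^ r \<le> (\<Sum>i\<in>I. x i ^ r)"
proof -
  obtain s where s: "r = Suc s" using r by (cases r) auto
  have pt: "a * c ^ s - c ^ r \<le> a ^ r" if "0 \<le> a" for a :: real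
  proof (cases "c \<le> a")
    case True
    then have "a * c ^ s \<le> a ^ r" using c that by (simp add: s mult_left_mono power_mono)
    then show ?thesis using zero_le_power[OF c, of r] by linarith
  next
    case False
    then have "a * c ^ s \<le> c ^ r" using c by (simp add: s mult_right_mono)
    then show ?thesis using zero_le_power[OF that, of r] by linarith
  qed
  have "2 * real (card I) * c * c ^ s \<le> (\<Sum>i\<in>I. x i) * c ^ s"
    using mean c by (intro mult_right_mono) auto
  then have "real (card I) * c ^ r \<le> (\<Sum>i\<in>I. x i) * c ^ s - real (card I) * c ^ r"
    by (simp add: s mult_ac)
  also have "\<dots> = (\<Sum>i\<in>I. x i * c ^ s - c ^ r)"
    by (simp add: sum_subtractf sum_distrib_right)
  also have "\<dots> \<le> (\<Sum>i\<in>I. x i ^ r)"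
    by (intro sum_mono pt nonneg)
  finally show ?thesis .
qed

text \<open>The subtracted 1 covers \<open>d < r\<close>, where the binomial vanishes while the
  power is at most 1.\<close>

lemma binomial_ge_power_minus_1:
  assumes "1 \<le> r"
  shows "(real d / real r) ^ r - 1 \<le> real (d choose r)"
proof (cases "r \<le> d")
  case True
  then show ?thesis using binomial_ge_n_over_k_pow_k[of r d, where 'a = real] by simp
next
  case False
  then have "(real d / real r) ^ r \<le> 1" using assms by (intro power_le_one) auto
  then show ?thesis by simp
qed

lemma handshake:
  assumes fin: "finite V" and graph: "is_graph V E"
  shows "(\<Sum>v\<in>V. card {u\<in>V. {u, v} \<in> E}) = 2 * card E"
proof -
  have E: "e \<subseteq> V" "card e = 2" if "e \<in> E" for e
    using graph that by (auto simp: is_graph_def)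
  have finE: "finite E" using E(1) fin by (meson Pow_iff finite_Pow_iff finite_subset subsetI)
  have "card {u\<in>V. {u, v} \<in> E} = card {e\<in>E. v \<in> e}" if "v \<in> V" for v
  proof (rule bij_betw_same_card)
    show "bij_betw (\<lambda>u. {u, v}) {u\<in>V. {u, v} \<in> E} {e\<in>E. v \<in> e}"
    proof (rule bij_betwI')
      fix e assume e: "e \<in> {e\<in>E. v \<in> e}"
      then have "card e = 2" using E(2) by simp
      then obtain a b where "e = {a, b}" by (auto simp: card_2_iff)
      then have "e = {a, v} \<or> e = {b, v}" using e by auto
      then show "\<exists>u\<in>{u\<in>V. {u, v} \<in> E}. e = {u, v}" using e E(1) by auto
    qed (auto simp: doubleton_eq_iff)
  qed
  then have "(\<Sum>v\<in>V. card {u\<in>V. {u, v} \<in> E}) = (\<Sum>v\<in>V. \<Sum>e\<in>{e\<in>E. v \<in> e}. 1)" by simp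
  also have "\<dots> = (\<Sum>e\<in>E. \<Sum>v\<in>{v\<in>V. v \<in> e}. 1)"
    by (rule sum.swap_restrict[OF fin finE])
  also have "\<dots> = (\<Sum>e\<in>E. 2)"
  proof (rule sum.cong[OF refl])
    fix e assume "e \<in> E"
    moreover from E(1)[OF this] have "{v\<in>V. v \<in> e} = e" by auto
    ultimately show "(\<Sum>v\<in>{v\<in>V. v \<in> e}. 1) = (2::nat)" using E(2) by simp
  qed
  finally show ?thesis by simp
qed

text \<open>Both sides count the pairs of a vertex \<open>v\<close> and an \<open>r\<close>-set
  inside its neighbourhood.\<close>

lemma sum_common_nbrs:
  assumes fin: "finite V"
  shows "(\<Sum>z | z \<subseteq> V \<and> card z = r. card (common_nbrs V E z))
       = (\<Sum>v\<in>V. card {u\<in>V. {u, v} \<in> E} choose r)"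
proof -
  let ?Z = "{z. z \<subseteq> V \<and> card z = r}"
  have "(\<Sum>z\<in>?Z. card (common_nbrs V E z)) = (\<Sum>z\<in>?Z. \<Sum>v\<in>{v\<in>V. \<forall>u\<in>z. {u, v} \<in> E}. 1)"
    by (simp add: common_nbrs_def)
  also have "\<dots> = (\<Sum>v\<in>V. \<Sum>z\<in>{z\<in>?Z. \<forall>u\<in>z. {u, v} \<in> E}. 1)"
    by (rule sum.swap_restrict) (use fin in auto)
  also have "\<dots> = (\<Sum>v\<in>V. card {u\<in>V. {u, v} \<in> E} choose r)"
  proof (rule sum.cong[OF refl])
    fix v
    have "{z\<in>?Z. \<forall>u\<in>z. {u, v} \<in> E} = {z. z \<subseteq> {u\<in>V. {u, v} \<in> E} \<and> card z = r}" by auto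
    then show "(\<Sum>z\<in>{z\<in>?Z. \<forall>u\<in>z. {u, v} \<in> E}. 1) = (card {u\<in>V. {u, v} \<in> E} choose r)"
      using n_subsets[of "{u\<in>V. {u, v} \<in> E}" r] fin by simp
  qed
  finally show ?thesis .
qed

text \<open>Lets the pruning threshold be absorbed by half of the degree count. From
  \<open>x = 4 * r^r * \<delta>\<close> on, the first summand on the right suffices; below that
  value the second one does.\<close>

lemma power_pred_le:
  fixes x \<delta> :: real
  assumes r: "1 \<le> r" and x: "0 \<le> x" and \<delta>: "0 < \<delta>"
  shows "2 * \<delta> * x ^ (r - 1) \<le> (x / real r) ^ r / 2 + 2 * (4 * real r ^ r) ^ (r - 1) * \<delta> ^ r"
proof -
  obtain s where s: "r = Suc s" using r by (cases r) auto
  define a where "a = real r ^ r"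
  have a: "0 < a" using r by (simp add: a_def)
  have eq: "2 * (4 * a) ^ s * \<delta> ^ r = 2 * \<delta> * (4 * a * \<delta>) ^ s"
    by (simp add: s power_mult_distrib)
  show ?thesis
  proof (cases "4 * a * \<delta> \<le> x")
    case True
    have "2 * \<delta> * x ^ s = (4 * a * \<delta>) * x ^ s / (2 * a)" using a by simp
    also have "\<dots> \<le> x * x ^ s / (2 * a)"
      using True x a by (intro divide_right_mono mult_right_mono) auto
    also have "\<dots> = (x / real r) ^ r / 2" by (simp add: a_def power_divide s)
    finally have "2 * \<delta> * x ^ s \<le> (x / real r) ^ r / 2" .
    moreover have "0 \<le> 2 * (4 * a) ^ s * \<delta> ^ r" using a \<delta> by simp
    ultimately have "2 * \<delta> * x ^ s \<le> (x / real r) ^ r / 2 + 2 * (4 * a) ^ s * \<delta> ^ r"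
      by linarith
    then show ?thesis by (simp add: a_def s)
  next
    case False
    then have "2 * \<delta> * x ^ s \<le> 2 * \<delta> * (4 * a * \<delta>) ^ s"
      using x \<delta> by (intro mult_left_mono power_mono) auto
    moreover have "0 \<le> (x / real r) ^ r / 2" using x by simp
    ultimately have "2 * \<delta> * x ^ s \<le> (x / real r) ^ r / 2 + 2 * (4 * a) ^ s * \<delta> ^ r"
      unfolding eq by linarith
    then show ?thesis by (simp add: a_def s)
  qed
qed

text \<open>With \<open>A = 2 * (4 * r^r)^(r-1)\<close>, the error constant of
  \<open>power_pred_le\<close>, this is \<open>2 * r * (2 * A + 7)\<close>. The 7 serves to exceed
  twice the total loss \<open>A + 3\<close> in the count below.\<close>

definition density_const :: "nat \<Rightarrow> real" where
  "density_const r = 2 * real r * (4 * (4 * real r ^ r) ^ (r - 1) + 7)"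

text \<open>The power mean inequality is used twice: from degrees to the sum of all
  \<open>d z\<close>, and from there to the sum of their \<open>r\<close>-th powers, which counts
  joined pairs up to constants. Here \<open>m\<close> is half the average degree.\<close>

lemma contains_blowup_if_dense:
  fixes V :: "'a set"
  assumes fin: "finite V" and graph: "is_graph V E" and r: "1 \<le> r" and k: "2 \<le> k"
    and n: "n = card V" "1 \<le> n" and avg: "m = real (card E) / real n"
    and m: "2 \<le> (m / real r) ^ r"
    and \<delta>: "\<delta> = real n * (m / real r) ^ r / (2 * real n ^ r) / density_const r" "1 \<le> \<delta>"
    and large: "(4 * real k ^ 2 * real r) ^ (k - 1) * real n ^ r < \<delta> ^ (k + r - 1)"
  shows "contains_copy V E (blowup_V (cycle_V (2 * k)) r) (blowup_E (cycle_E (2 * k)) r)"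
proof -
  define Z where "Z = {z. z \<subseteq> V \<and> card z = r}"
  define d where "d z = real (card (common_nbrs V E z))" for z
  define deg where "deg v = card {u\<in>V. {u, v} \<in> E}" for v
  define A where "A = 2 * (4 * real r ^ r) ^ (r - 1)"
  \<comment> \<open>Half of the main term of the first count, spread over \<open>n^r\<close>, which
    is at least the number of \<open>r\<close>-sets; hence a lower bound for the mean of
    \<open>d\<close>.\<close>
  define D where "D = real n * (m / real r) ^ r / (2 * real n ^ r)"
  have A: "0 \<le> A" by (simp add: A_def)
  have dc: "density_const r = 2 * real r * (2 * A + 7)" by (simp add: density_const_def A_def)
  have dc_pos: "0 < density_const r" using r A by (simp add: dc)
  have D_eq: "D / (2 * real r) = (2 * A + 7) * \<delta>"
    using r A unfolding \<delta>(1) D_def[symmetric] dc by simp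
  have D_pos: "0 < D"
    using n m unfolding D_def by (intro divide_pos_pos mult_pos_pos) auto
  have m0: "0 \<le> m" by (simp add: avg)
  have finZ: "finite Z" using fin by (simp add: Z_def)
  have "(\<Sum>v\<in>V. real (deg v)) = real (2 * card E)"
    unfolding deg_def handshake[OF fin graph, symmetric] by simp
  then have "2 * real (card V) * m \<le> (\<Sum>v\<in>V. real (deg v))"
    using n by (simp add: avg)
  then have "real n * m ^ r \<le> (\<Sum>v\<in>V. real (deg v) ^ r)"
    unfolding n(1) by (intro sum_power_ge r m0) auto
  then have "real n * (m / real r) ^ r \<le> (\<Sum>v\<in>V. (real (deg v) / real r) ^ r)"
    by (simp add: power_divide sum_divide_distrib[symmetric] divide_right_mono)
  then have "real n * (m / real r) ^ r - real n \<le> (\<Sum>v\<in>V. (real (deg v) / real r) ^ r - 1)"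
    by (simp add: sum_subtractf n(1))
  also have "\<dots> \<le> (\<Sum>v\<in>V. real (deg v choose r))"
    by (intro sum_mono binomial_ge_power_minus_1 r)
  also have "\<dots> = (\<Sum>z\<in>Z. d z)"
    using sum_common_nbrs[OF fin, where r = r and E = E] by (simp add: deg_def d_def Z_def flip: of_nat_sum)
  finally have lower: "real n * (m / real r) ^ r - real n \<le> (\<Sum>z\<in>Z. d z)" .
  \<comment> \<open>The hypothesis on \<open>m\<close> makes the loss \<open>n\<close> at most half
    of the main term.\<close>
  have "real n * 2 \<le> real n * (m / real r) ^ r"
    using m by (intro mult_left_mono) auto
  then have "real n * (m / real r) ^ r / 2 \<le> (\<Sum>z\<in>Z. d z)"
    using lower by linarith
  moreover have "real n ^ r * D = real n * (m / real r) ^ r / 2"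
    using n(2) by (simp add: D_def)
  ultimately have sum_d: "real n ^ r * D \<le> (\<Sum>z\<in>Z. d z)" by linarith
  have cardZ: "real (card Z) \<le> real n ^ r"
    using binomial_le_power[of n r] n_subsets[OF fin, of r]
    by (simp add: Z_def n(1) flip: of_nat_power)
  have Z_pos: "0 < real (card Z)"
  proof (rule ccontr)
    assume "\<not> 0 < real (card Z)"
    then have "Z = {}" using finZ by auto
    then have "real n ^ r * D \<le> 0" using sum_d by simp
    moreover have "0 < real n ^ r * D" using n(2) D_pos by simp
    ultimately show False by simp
  qed
  have "real (card Z) * D \<le> real n ^ r * D"
    using cardZ D_pos by (intro mult_right_mono) auto
  then have "2 * real (card Z) * (D / 2) \<le> (\<Sum>z\<in>Z. d z)"
    using sum_d by linarith
  then have "real (card Z) * (D / 2) ^ r \<le> (\<Sum>z\<in>Z. d z ^ r)"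
    using D_pos by (intro sum_power_ge r) (auto simp: d_def)
  then have "real (card Z) * (D / 2) ^ r / real r ^ r \<le> (\<Sum>z\<in>Z. d z ^ r) / real r ^ r"
    by (rule divide_right_mono) simp
  then have "real (card Z) * (D / (2 * real r)) ^ r \<le> (\<Sum>z\<in>Z. (d z / real r) ^ r)"
    by (simp add: power_divide power_mult_distrib sum_divide_distrib)
  then have powers: "real (card Z) * ((2 * A + 7) ^ r * \<delta> ^ r) \<le> (\<Sum>z\<in>Z. (d z / real r) ^ r)"
    by (simp only: D_eq power_mult_distrib)
  have \<delta>r: "1 \<le> \<delta> ^ r" using \<delta>(2) by simp
  have "2 * (\<Sum>z\<in>Z. \<delta> * d z ^ (r - 1) + \<delta> ^ r) = (\<Sum>z\<in>Z. 2 * \<delta> * d z ^ (r - 1) + 2 * \<delta> ^ r)"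
    by (simp add: sum_distrib_left algebra_simps)
  \<comment> \<open>The 3 collects \<open>2 * \<delta> ^ r\<close> from the threshold and the
    subtracted 1, which is at most \<open>\<delta> ^ r\<close>.\<close>
  also have "\<dots> \<le> (\<Sum>z\<in>Z. (d z / real r) ^ r - 1 + ((A + 3) * \<delta> ^ r - (d z / real r) ^ r / 2))"
  proof (rule sum_mono)
    fix z
    have "2 * \<delta> * d z ^ (r - 1) \<le> (d z / real r) ^ r / 2 + A * \<delta> ^ r"
      unfolding A_def using \<delta>(2) by (intro power_pred_le r) (auto simp: d_def)
    then show "2 * \<delta> * d z ^ (r - 1) + 2 * \<delta> ^ r
        \<le> (d z / real r) ^ r - 1 + ((A + 3) * \<delta> ^ r - (d z / real r) ^ r / 2)"
      using \<delta>r unfolding distrib_right by linarith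
  qed
  also have "\<dots> = (\<Sum>z\<in>Z. (d z / real r) ^ r - 1)
      + (real (card Z) * ((A + 3) * \<delta> ^ r) - (\<Sum>z\<in>Z. (d z / real r) ^ r) / 2)"
    unfolding sum_divide_distrib sum.distrib sum_subtractf by simp
  also have "\<dots> < (\<Sum>z\<in>Z. (d z / real r) ^ r - 1)"
  proof -
    have "(2 * A + 7) ^ 1 \<le> (2 * A + 7) ^ r"
      using A r by (intro power_increasing) auto
    then have "2 * (A + 3) < (2 * A + 7) ^ r" by simp
    then have "2 * (A + 3) * \<delta> ^ r < (2 * A + 7) ^ r * \<delta> ^ r"
      using \<delta>r by (intro mult_strict_right_mono) auto
    then have "real (card Z) * (2 * (A + 3) * \<delta> ^ r) < real (card Z) * ((2 * A + 7) ^ r * \<delta> ^ r)"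
      using Z_pos by (intro mult_strict_left_mono) auto
    then have "real (card Z) * (2 * (A + 3) * \<delta> ^ r) < (\<Sum>z\<in>Z. (d z / real r) ^ r)"
      using powers by (rule less_le_trans)
    then have "2 * (real (card Z) * ((A + 3) * \<delta> ^ r)) < (\<Sum>z\<in>Z. (d z / real r) ^ r)"
      by (simp only: mult.assoc mult.left_commute[of 2])
    then show ?thesis by linarith
  qed
  also have "\<dots> \<le> (\<Sum>z\<in>Z. real (card (common_nbrs V E z) choose r))"
    unfolding d_def by (intro sum_mono binomial_ge_power_minus_1 r)
  finally show ?thesis
    using \<delta>(2) large unfolding n(1)
    by (intro contains_blowup_if_many_joined_pairs[OF fin graph r k, of \<delta>]) (auto simp: Z_def d_def)
qed

section \<open>From dense graphs to the extremal number\<close>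

lemma extremal_graph_exists:
  assumes "EH \<noteq> {}"
  obtains E where "is_graph {0..<n} E" "\<not> contains_copy {0..<n} E VH EH" "ex_num n VH EH = card E"
proof -
  let ?S = "{card E | E. is_graph {0..<n} E \<and> \<not> contains_copy {0..<n} E VH EH}"
  have "?S \<subseteq> card ` Pow (Pow {0..<n})" by (auto simp: is_graph_def)
  then have "finite ?S" by (rule finite_subset) simp
  \<comment> \<open>The edgeless graph is a candidate because \<open>EH\<close> has an edge, so the
    maximum is attained.\<close>
  moreover have "card ({} :: nat set set) \<in> ?S"
    using assms by (intro CollectI exI[of _ "{}"]) (auto simp: is_graph_def contains_copy_def)
  ultimately have "Max ?S \<in> ?S" by (intro Max_in) auto
  then show ?thesis using that unfolding ex_num_def by blast
qed

lemma blowup_cycle_nonempty: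
  assumes "1 \<le> r" "2 \<le> k"
  shows "blowup_E (cycle_E (2 * k)) r \<noteq> {}"
proof -
  have "{0, 1} \<in> cycle_E (2 * k)" using assms by (auto simp: cycle_E_def intro!: exI[of _ 0])
  then have "{(0, 0), (1, 0)} \<in> blowup_E (cycle_E (2 * k)) r"
    unfolding blowup_E_def using assms by force
  then show ?thesis by blast
qed

lemma ex_blowup_cycle_le:
  assumes r: "1 \<le> r" and k: "2 \<le> k"
  shows "\<exists>C. 0 \<le> C \<and> (\<forall>n\<ge>1. real (ex_num n (blowup_V (cycle_V (2 * k)) r) (blowup_E (cycle_E (2 * k)) r))
    \<le> C * real n powr (2 - 1 / real r + 1 / real (k + r - 1)))"
proof -
  define q where "q = k + r - 1"
  have q: "1 \<le> q" using r k by (simp add: q_def)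
  \<comment> \<open>\<open>B\<close> exceeds the constant of the condition on
    \<open>\<delta> ^ q\<close>; \<open>K\<close> collects the denominators, so that
    \<open>\<delta> = m^r * n / (K * n^r)\<close>; \<open>C\<close> ensures
    \<open>C^r >= K * B\<close> and \<open>m >= 2 * r\<close>.\<close>
  define B where "B = (4 * real k ^ 2 * real r) ^ (k - 1) + 1"
  define K where "K = 2 * real r ^ r * density_const r"
  define C where "C = K * B + 2 * real r"
  have B: "1 \<le> B" by (simp add: B_def)
  have K: "0 < K" using r unfolding K_def density_const_def by (intro mult_pos_pos add_nonneg_pos) auto
  have C: "2 * real r \<le> C" "K * B \<le> C" "1 \<le> C"
    using r K B mult_nonneg_nonneg[of K B] unfolding C_def by linarith+
  have copy: "contains_copy {0..<n} E (blowup_V (cycle_V (2 * k)) r) (blowup_E (cycle_E (2 * k)) r)"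
    if n: "1 \<le> n" and graph: "is_graph {0..<n} E"
      and dense: "C * real n powr (2 - 1 / real r + 1 / real q) < real (card E)" for n E
  proof -
    define m where "m = real (card E) / real n"
    define \<alpha> where "\<alpha> = 1 - 1 / real r + 1 / real q"
    define \<delta> where "\<delta> = real n * (m / real r) ^ r / (2 * real n ^ r) / density_const r"
    have n0: "0 < real n" using n by simp
    have \<alpha>: "0 \<le> \<alpha>" using r by (simp add: \<alpha>_def)
    have "real n powr (2 - 1 / real r + 1 / real q) = real n * real n powr \<alpha>"
      using n0 by (simp add: \<alpha>_def powr_mult_base algebra_simps)
    then have m_ge: "C * real n powr \<alpha> \<le> m"
      using dense n0 by (simp add: m_def pos_le_divide_eq mult_ac)
    have "1 \<le> real n powr \<alpha>" using \<alpha> n by (intro ge_one_powr_ge_zero) auto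
    then have "C * 1 \<le> C * real n powr \<alpha>" using C by (intro mult_left_mono) auto
    then have m_C: "C \<le> m" using m_ge by linarith
    have mr: "2 \<le> (m / real r) ^ r"
    proof -
      have "2 \<le> m / real r" using m_C C(1) r by (simp add: pos_le_divide_eq)
      moreover from this have "(m / real r) ^ 1 \<le> (m / real r) ^ r"
        using r by (intro power_increasing) linarith+
      ultimately show ?thesis by simp
    qed
    have \<delta>_ge: "B * real n powr (real r / real q) \<le> \<delta>"
    proof -
      \<comment> \<open>This identity, \<open>\<alpha> * r + 1 = r + r / q\<close>, is what
        determines the exponent: it makes \<delta> of order \<open>n^(r/q)\<close>, so that
        \<open>\<delta> ^ q\<close> competes with \<open>n^r\<close>.\<close>
      have "(real n powr \<alpha>) ^ r * real n = real n ^ r * real n powr (real r / real q)"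
      proof -
        have "(real n powr \<alpha>) ^ r * real n = real n powr (\<alpha> * real r + 1)"
          using n0 by (simp add: powr_powr powr_add flip: powr_realpow)
        also have "\<alpha> * real r + 1 = real r + real r / real q"
          using r by (simp add: \<alpha>_def field_simps)
        also have "real n powr \<dots> = real n ^ r * real n powr (real r / real q)"
          using n0 by (simp add: powr_add powr_realpow)
        finally show ?thesis .
      qed
      then have eq: "real n powr (real r / real q) = (real n powr \<alpha>) ^ r * real n / real n ^ r"
        using n0 by (simp add: field_simps)
      have "K * B \<le> C ^ r"
        using C r power_increasing[of 1 r C] by simp
      then have "K * B * (real n powr \<alpha>) ^ r \<le> C ^ r * (real n powr \<alpha>) ^ r"
        by (intro mult_right_mono) auto
      also have "\<dots> = (C * real n powr \<alpha>) ^ r" by (simp add: power_mult_distrib)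
      also have "\<dots> \<le> m ^ r" using m_ge C by (intro power_mono) auto
      finally have "B * (real n powr \<alpha>) ^ r \<le> m ^ r / K"
        using K by (simp add: pos_le_divide_eq mult_ac)
      then have "B * (real n powr \<alpha>) ^ r * (real n / real n ^ r) \<le> m ^ r / K * (real n / real n ^ r)"
        by (intro mult_right_mono) auto
      also have "\<dots> = \<delta>" by (simp add: \<delta>_def K_def power_divide mult_ac)
      finally show ?thesis by (simp add: eq mult_ac)
    qed
    have one: "1 \<le> real n powr (real r / real q)" using n by (intro ge_one_powr_ge_zero) auto
    have "1 * 1 \<le> B * real n powr (real r / real q)"
      using B one by (intro mult_mono) auto
    then have \<delta>1: "1 \<le> \<delta>" using \<delta>_ge by linarith
    have large: "(4 * real k ^ 2 * real r) ^ (k - 1) * real n ^ r < \<delta> ^ q"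
    proof -
      have "(4 * real k ^ 2 * real r) ^ (k - 1) * real n ^ r < B * real n ^ r"
        using n0 by (simp add: B_def)
      also have "\<dots> \<le> B ^ q * real n ^ r"
        using B q power_increasing[of 1 q B] by (intro mult_right_mono) auto
      also have "\<dots> = (B * real n powr (real r / real q)) ^ q"
        using n0 q by (simp add: power_mult_distrib powr_powr flip: powr_realpow)
      also have "\<dots> \<le> \<delta> ^ q" using \<delta>_ge B by (intro power_mono) auto
      finally show ?thesis .
    qed
    show ?thesis
      by (rule contains_blowup_if_dense[OF _ graph r k _ n m_def mr \<delta>_def \<delta>1])
        (use large in \<open>simp_all add: q_def\<close>)
  qed
  have "real (ex_num n (blowup_V (cycle_V (2 * k)) r) (blowup_E (cycle_E (2 * k)) r))
      \<le> C * real n powr (2 - 1 / real r + 1 / real q)" if "1 \<le> n" for n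
  proof -
    obtain E where "is_graph {0..<n} E"
      "\<not> contains_copy {0..<n} E (blowup_V (cycle_V (2 * k)) r) (blowup_E (cycle_E (2 * k)) r)"
      "ex_num n (blowup_V (cycle_V (2 * k)) r) (blowup_E (cycle_E (2 * k)) r) = card E"
      by (rule extremal_graph_exists[OF blowup_cycle_nonempty[OF r k]])
    then show ?thesis using copy[OF that] by (metis not_le)
  qed
  then show ?thesis using C(3) unfolding q_def by (intro exI[of _ C]) auto
qed

theorem theorem1p15:
  fixes r k :: nat
  assumes "r \<ge> 1" and "k \<ge> 2"
  shows "(\<lambda>n. real (ex_num n (blowup_V (cycle_V (2*k)) r) (blowup_E (cycle_E (2*k)) r)))
    \<in> O(\<lambda>n. real n powr (2 - 1 / real r + 1 / real (k + r - 1))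
             * (log 2 (real n)) powr (4 * real k / (real r * real (k + r - 1))))"
proof -
  let ?p = "\<lambda>n. real n powr (2 - 1 / real r + 1 / real (k + r - 1))"
  let ?l = "\<lambda>n. (log 2 (real n)) powr (4 * real k / (real r * real (k + r - 1)))"
  obtain C where C: "0 \<le> C" "\<And>n. 1 \<le> n \<Longrightarrow>
      real (ex_num n (blowup_V (cycle_V (2*k)) r) (blowup_E (cycle_E (2*k)) r)) \<le> C * ?p n"
    using ex_blowup_cycle_le[OF assms] by blast
  show ?thesis
  proof (rule bigoI[where c = C], rule eventually_sequentiallyI[of 2])
    fix n :: nat assume n: "2 \<le> n"
    \<comment> \<open>From \<open>n = 2\<close> on the logarithm is at least 1, and its exponent is
      nonnegative, so the logarithmic factor can be multiplied onto the bound.\<close>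
    have "1 \<le> log 2 (real n)" using n by (simp add: le_log_iff)
    then have "1 \<le> ?l n" by (intro ge_one_powr_ge_zero) auto
    then have "C * ?p n * 1 \<le> C * ?p n * ?l n"
      using C(1) by (intro mult_left_mono) auto
    then have "real (ex_num n (blowup_V (cycle_V (2*k)) r) (blowup_E (cycle_E (2*k)) r)) \<le> C * (?p n * ?l n)"
      using C(2)[of n] n by (simp add: mult.assoc)
    then show "norm (real (ex_num n (blowup_V (cycle_V (2*k)) r) (blowup_E (cycle_E (2*k)) r)))
        \<le> C * norm (?p n * ?l n)" by (simp add: abs_mult)
  qed
qed

end
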